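(* Let $X$ be a Banach space. If $\mathcal{L}(X) = \mathrm{NRA}(X)$ (that is, every bounded linear operator on $X$ attains its numerical radius), then $X$ is a separable reflexive space.
   Context: Banach spaces are over $\mathbb{K}=\mathbb{R}$ or $\mathbb{C}$. $S_X$ is the unit sphere of $X$, $X^*$ is the topological dual, and $\mathcal{L}(X)$ is the space of all bounded linear operators from $X$ into $X$. Set $\Pi(X) = \{(x,x^* ) \in S_X \times S_{X^*} : x^*(x)=1\}$. The numerical radius of $T \in \mathcal{L}(X)$ is $\nu(T) = \sup\{|x^*(T(x))| : (x,x^* ) \in \Pi(X)\}$. The operator $T$ attains its numerical radius if there is $(x,x^* ) \in \Pi(X)$ with $\nu(T) = |x^*(T(x))|$; $\mathrm{NRA}(X)$ is the set of all numerical radius attaining operators $T\in\mathcal{L}(X)$. *)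

theory Defs
  imports "HOL-Analysis.Analysis"
begin

text \<open>
  A scalar field is \<open>\<real>\<close> or \<open>\<complex>\<close>: it has an isometric embedding of fields into
  \<^typ>\<open>complex\<close> whose range is either \<open>\<real>\<close> or the whole of \<open>\<complex>\<close>.
\<close>

class real_or_complex_field = real_normed_field +
  assumes real_or_complex:
    "\<exists>h :: 'a \<Rightarrow> complex.
       (\<forall>x y. h (x + y) = h x + h y) \<and>
       (\<forall>x y. h (x * y) = h x * h y) \<and>
       (\<forall>r x. h (r *\<^sub>R x) = r *\<^sub>R h x) \<and>
       h 1 = 1 \<and>
       (\<forall>x. norm (h x) = norm x) \<and>
       (range h = \<real> \<or> range h = UNIV)"

instance real :: real_or_complex_field
  by standard (rule exI[of _ complex_of_real], auto simp: scaleR_conv_of_real Reals_def)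

instance complex :: real_or_complex_field
  by standard (rule exI[of _ "\<lambda>x. x"], auto)

text \<open>
  A Banach space over \<open>\<K>\<close>. The type class \<^class>\<open>banach\<close> supplies addition, the complete norm
  and the multiplication by real scalars; \<open>smul\<close> extends the latter to \<open>\<K>\<close>.
  For \<open>\<K> = \<real>\<close> the axioms force \<open>smul\<close> to be \<^term>\<open>scaleR\<close>.
\<close>

locale banach_over = vector_space smul
  for smul :: "'k::real_or_complex_field \<Rightarrow> 'a::banach \<Rightarrow> 'a" +
  assumes scale_of_real: "smul (of_real r) x = r *\<^sub>R x"
    and norm_scale: "norm (smul c x) = norm c * norm x"

lemma banach_over_real_iff:
  "banach_over (smul :: real \<Rightarrow> 'a::banach \<Rightarrow> 'a) \<longleftrightarrow> smul = scaleR"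
proof
  assume "banach_over smul"
  then interpret banach_over smul .
  show "smul = scaleR"
    using scale_of_real by (intro ext) simp
next
  assume "smul = scaleR"
  then show "banach_over smul"
    by (simp add: banach_over_def banach_over_axioms_def vector_space_def
        scaleR_add_right scaleR_add_left)
qed

text \<open>
  In the next two definitions \<^const>\<open>bounded_linear\<close> contributes boundedness (and linearity over
  \<open>\<real>\<close>) and \<^const>\<open>Vector_Spaces.linear\<close> linearity over \<open>\<K>\<close>.
\<close>

definition operators :: "('k::real_normed_field \<Rightarrow> 'a::real_normed_vector \<Rightarrow> 'a) \<Rightarrow> ('a \<Rightarrow> 'a) set"
  where "operators smul = {T. Vector_Spaces.linear smul smul T \<and> bounded_linear T}"

definition dual :: "('k::real_normed_field \<Rightarrow> 'a::real_normed_vector \<Rightarrow> 'a) \<Rightarrow> ('a \<Rightarrow> 'k) set"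
  where "dual smul = {f. Vector_Spaces.linear smul (*) f \<and> bounded_linear f}"

definition states ::
    "('k::real_normed_field \<Rightarrow> 'a::real_normed_vector \<Rightarrow> 'a) \<Rightarrow> ('a \<times> ('a \<Rightarrow> 'k)) set"
  where "states smul = {(x, f). norm x = 1 \<and> f \<in> dual smul \<and> onorm f = 1 \<and> f x = 1}"

text \<open>
  On the zero space \<^const>\<open>states\<close> is empty; the supremum is then an unspecified number, but no
  operator attains it.
\<close>

definition numerical_radius ::
    "('k::real_normed_field \<Rightarrow> 'a::real_normed_vector \<Rightarrow> 'a) \<Rightarrow> ('a \<Rightarrow> 'a) \<Rightarrow> real"
  where "numerical_radius smul T = (SUP (x, f) \<in> states smul. norm (f (T x)))"

definition NRA :: "('k::real_normed_field \<Rightarrow> 'a::real_normed_vector \<Rightarrow> 'a) \<Rightarrow> ('a \<Rightarrow> 'a) set"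
  where "NRA smul = {T \<in> operators smul.
    \<exists>(x, f) \<in> states smul. numerical_radius smul T = norm (f (T x))}"

text \<open>
  The elements of the bidual are functions on the set \<^const>\<open>dual\<close>; being \<^const>\<open>extensional\<close>
  makes each of them a unique HOL function.
\<close>

definition bidual ::
    "('k::real_normed_field \<Rightarrow> 'a::real_normed_vector \<Rightarrow> 'a) \<Rightarrow> (('a \<Rightarrow> 'k) \<Rightarrow> 'k) set"
  where "bidual smul = {\<phi> \<in> extensional (dual smul).
    (\<forall>f\<in>dual smul. \<forall>g\<in>dual smul. \<phi> (\<lambda>x. f x + g x) = \<phi> f + \<phi> g) \<and>
    (\<forall>c. \<forall>f\<in>dual smul. \<phi> (\<lambda>x. c * f x) = c * \<phi> f) \<and>
    (\<exists>B. \<forall>f\<in>dual smul. norm (\<phi> f) \<le> B * onorm f)}"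

definition canonical_embedding ::
    "('k::real_normed_field \<Rightarrow> 'a::real_normed_vector \<Rightarrow> 'a) \<Rightarrow> 'a \<Rightarrow> (('a \<Rightarrow> 'k) \<Rightarrow> 'k)"
  where "canonical_embedding smul x = (\<lambda>f\<in>dual smul. f x)"

definition reflexive_space :: "('k::real_normed_field \<Rightarrow> 'a::real_normed_vector \<Rightarrow> 'a) \<Rightarrow> bool"
  where "reflexive_space smul \<longleftrightarrow> range (canonical_embedding smul) = bidual smul"

end

theory Submission
  imports Defs "HOL-Library.Diagonal_Subsequence"
begin

text \<open>
  Both conclusions rest on one obstruction to attaining suprema, \<open>no_attained_limit\<close>. Let \<open>W\<close> be
  a bounded set of functionals on a Banach space, \<open>f n\<close> a bounded sequence of vectors, and
  suppose that every convex combination \<open>u\<close> of the \<open>f n\<close> stays, in the sense of the supremum over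
  \<open>W\<close>, at least \<open>\<theta> > 0\<close> above every \<open>w\<close> that the \<open>f n\<close> cluster at, pointwise on \<open>W\<close>. If this
  supremum does not depend on which \<open>w\<close> is taken, then an infinite convex combination of convex
  blocks \<open>g n\<close> of the \<open>f n\<close>, chosen greedily and with fast decaying weights, minus a cluster point
  of the \<open>g n\<close>, does not attain its supremum on \<open>W\<close>. This combines the ideas of James, Pryce and Simons.

  Reflexivity. Fix a unit vector \<open>x0\<close>. For a functional \<open>f\<close>, the numerical radius of the rank-one
  operator \<open>y \<mapsto> f(y) x0\<close> is the supremum of \<open>\<bar>f\<bar>\<close> over the bounded set of all vectors \<open>g(x0) y\<close>,
  where \<open>(y, g)\<close> is a state. So every functional attains its maximum modulus on this set.
  The set is also large: the supremum is at least \<open>\<parallel>f\<parallel>/20\<close> (\<open>rank_one_norming\<close>). James's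
  theorem holds for such a set just as it does for the unit ball (\<open>James\<close>), and reflexivity follows.
  James's theorem itself is obtained from the obstruction: an element of the bidual outside the space
  yields functionals \<open>f n\<close> that eventually vanish at each of countably many points of \<open>W\<close>, while
  every convex combination of them is large at one of these points; a diagonal argument then produces
  the independence of \<open>w\<close>.

  Separability. Suppose that the reflexive space is not separable. A set that is closed under
  countably many operations, among them a choice of norming functionals and norming vectors, spans a
  separable subspace that is the range of a projection of norm one. Increasing such sets give
  increasing projections \<open>P n\<close> that converge strongly to a projection \<open>P\<close>. The operators
  \<open>P - P n\<close> tend to \<open>0\<close> pointwise, and any convex combination of them fixes a nonzero
  vector, so that its numerical radius is at least \<open>1\<close>. Every operator in the closed convex hull of
  the \<open>P - P n\<close> attains its numerical radius by hypothesis, and the obstruction, with \<open>w = 0\<close>, gives a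
  contradiction.

  Everything analytic is done with real-linear functionals. The passage from and to \<open>\<K>\<close>-linear
  functionals uses that a \<open>\<K>\<close>-linear functional is determined by its real part, and that a value
  can be rotated into its modulus by a scalar of modulus one.
\<close>

section \<open>Sublinear functionals and the Hahn--Banach theorem\<close>

text \<open>
  Only one half of positive homogeneity is demanded, which makes infima of families easy to treat;
  the other half follows by scaling with the inverse (\<open>sublinear_scale\<close>).
\<close>

definition sublinear :: "('a::real_vector \<Rightarrow> real) \<Rightarrow> bool"
  where "sublinear p \<longleftrightarrow> (\<forall>x y. p (x + y) \<le> p x + p y) \<and> (\<forall>r>0. \<forall>x. p (r *\<^sub>R x) \<le> r * p x)"

lemma sublinear_add: "sublinear p \<Longrightarrow> p (x + y) \<le> p x + p y"
  by (simp add: sublinear_def)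

lemma sublinear_scale_le: "sublinear p \<Longrightarrow> 0 < r \<Longrightarrow> p (r *\<^sub>R x) \<le> r * p x"
  by (simp add: sublinear_def)

lemma sublinear_zero: "sublinear p \<Longrightarrow> p 0 = 0"
  using sublinear_scale_le[of p 2 0] sublinear_scale_le[of p "1/2" 0] by simp

lemma sublinear_scale:
  assumes "sublinear p" "0 \<le> r" shows "p (r *\<^sub>R x) = r * p x"
proof (cases "r = 0")
  case False
  then have "r > 0" using assms by simp
  then have "p x \<le> inverse r * p (r *\<^sub>R x)"
    using sublinear_scale_le[OF assms(1), of "inverse r" "r *\<^sub>R x"] by simp
  then have "r * p x \<le> p (r *\<^sub>R x)" using \<open>r > 0\<close> by (simp add: field_simps)
  then show ?thesis using sublinear_scale_le[OF assms(1) \<open>r > 0\<close>, of x] by simp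
qed (simp add: sublinear_zero assms)

lemma sublinear_minus: "sublinear p \<Longrightarrow> - p (- x) \<le> p x"
  using sublinear_add[of p x "- x"] sublinear_zero[of p] by simp

text \<open>
  The main source of sublinear functionals below: distances to subspaces, infima of chains, upper
  limits and extension problems are all infima of sets \<open>\<Phi> x\<close> that are compatible with the
  operations up to passing to smaller elements.
\<close>

lemma sublinear_Inf:
  fixes \<Phi> :: "'a::real_vector \<Rightarrow> real set"
  assumes ne: "\<And>x. \<Phi> x \<noteq> {}" and bdd: "\<And>x. bdd_below (\<Phi> x)"
    and add: "\<And>a b x y. a \<in> \<Phi> x \<Longrightarrow> b \<in> \<Phi> y \<Longrightarrow> \<exists>c\<in>\<Phi> (x + y). c \<le> a + b"
    and scale: "\<And>r a x. 0 < r \<Longrightarrow> a \<in> \<Phi> x \<Longrightarrow> \<exists>c\<in>\<Phi> (r *\<^sub>R x). c \<le> r * a"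
  shows "sublinear (\<lambda>x. Inf (\<Phi> x))"
  unfolding sublinear_def
proof (intro conjI allI impI)
  fix x y
  have *: "Inf (\<Phi> (x + y)) \<le> a + b" if "a \<in> \<Phi> x" "b \<in> \<Phi> y" for a b
    using add[OF that] bdd by (meson cInf_lower order_trans)
  have "Inf (\<Phi> (x + y)) - b \<le> Inf (\<Phi> x)" if "b \<in> \<Phi> y" for b
    by (rule cInf_greatest[OF ne]) (use *[OF _ that] in \<open>simp add: algebra_simps\<close>)
  then have "Inf (\<Phi> (x + y)) - Inf (\<Phi> x) \<le> Inf (\<Phi> y)"
    by (intro cInf_greatest[OF ne]) (simp add: algebra_simps)
  then show "Inf (\<Phi> (x + y)) \<le> Inf (\<Phi> x) + Inf (\<Phi> y)" by simp
next
  fix r x assume "(0::real) < r"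
  have "Inf (\<Phi> (r *\<^sub>R x)) / r \<le> Inf (\<Phi> x)"
  proof (rule cInf_greatest[OF ne])
    fix a assume "a \<in> \<Phi> x"
    then obtain c where "c \<in> \<Phi> (r *\<^sub>R x)" "c \<le> r * a" using scale \<open>0 < r\<close> by blast
    then have "Inf (\<Phi> (r *\<^sub>R x)) \<le> r * a" using bdd by (meson cInf_lower order_trans)
    then show "Inf (\<Phi> (r *\<^sub>R x)) / r \<le> a" using \<open>0 < r\<close> by (simp add: field_simps)
  qed
  then show "Inf (\<Phi> (r *\<^sub>R x)) \<le> r * Inf (\<Phi> x)" using \<open>0 < r\<close> by (simp add: field_simps)
qed

text \<open>
  The infimum of \<open>p (x + t y) - t p y\<close> over \<open>t \<ge> 0\<close> does it: \<open>t = 0\<close> shows that it lies below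
  \<open>p\<close>, and \<open>t = 1\<close> gives the value at \<open>- y\<close>. A functional that cannot be lowered in this
  way is odd, hence linear.
\<close>

lemma sublinear_tilt:
  assumes p: "sublinear p"
  shows "\<exists>q. sublinear q \<and> (\<forall>x. q x \<le> p x) \<and> q (- y) \<le> - p y"
proof (intro exI conjI allI)
  let ?\<Phi> = "\<lambda>x. (\<lambda>t. p (x + t *\<^sub>R y) - t * p y) ` {0..}"
  have lower: "- p (- x) \<le> p (x + t *\<^sub>R y) - t * p y" if "0 \<le> t" for x t
    using sublinear_add[OF p, of "x + t *\<^sub>R y" "- x"] sublinear_scale[OF p that, of y] by simp
  have bdd: "bdd_below (?\<Phi> x)" for x
    using lower by (auto intro!: bdd_belowI2)
  show "sublinear (\<lambda>x. Inf (?\<Phi> x))"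
  proof (rule sublinear_Inf)
    fix a b x z assume "a \<in> ?\<Phi> x" "b \<in> ?\<Phi> z"
    then obtain t s where ts: "0 \<le> t" "0 \<le> s" "a = p (x + t *\<^sub>R y) - t * p y" "b = p (z + s *\<^sub>R y) - s * p y"
      by auto
    have "p (x + z + (t + s) *\<^sub>R y) - (t + s) * p y \<le> a + b"
      using sublinear_add[OF p, of "x + t *\<^sub>R y" "z + s *\<^sub>R y"] ts(3,4) by (simp add: algebra_simps)
    with ts(1,2) show "\<exists>c\<in>?\<Phi> (x + z). c \<le> a + b" by (intro bexI[where x="p (x + z + (t + s) *\<^sub>R y) - (t + s) * p y"]) auto
  next
    fix r a x assume "(0::real) < r" "a \<in> ?\<Phi> x"
    then obtain t where t: "0 \<le> t" "a = p (x + t *\<^sub>R y) - t * p y" by auto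
    have "p (r *\<^sub>R x + (r * t) *\<^sub>R y) - (r * t) * p y \<le> r * a"
      using sublinear_scale_le[OF p \<open>0 < r\<close>, of "x + t *\<^sub>R y"] unfolding t(2) by (simp add: algebra_simps)
    then show "\<exists>c\<in>?\<Phi> (r *\<^sub>R x). c \<le> r * a"
      using t \<open>0 < r\<close> by (intro bexI[where x="p (r *\<^sub>R x + (r * t) *\<^sub>R y) - (r * t) * p y"]) auto
  qed (use bdd in auto)
  show "Inf (?\<Phi> x) \<le> p x" for x
    using bdd[of x] by (intro cInf_lower) (auto intro!: image_eqI[where x=0])
  show "Inf (?\<Phi> (- y)) \<le> - p y"
    using bdd[of "- y"] sublinear_zero[OF p] by (intro cInf_lower) (auto intro!: image_eqI[where x=1])
qed

theorem sublinear_dominates_linear: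
  assumes p: "sublinear p"
  shows "\<exists>L. linear L \<and> (\<forall>x. L x \<le> p x)"
proof -
  let ?A = "{q. sublinear q \<and> (\<forall>x. q x \<le> p x)}"
  let ?P = "\<lambda>q q'. \<forall>x::'a. q' x \<le> (q x :: real)"
  have "\<exists>m\<in>?A. \<forall>a\<in>?A. ?P m a \<longrightarrow> a = m"
  proof (rule predicate_Zorn)
    show "partial_order_on ?A (relation_of ?P ?A)"
      by (rule partial_order_on_relation_ofI) (auto intro: order_trans intro!: ext antisym)
  next
    fix C assume C: "C \<in> Chains (relation_of ?P ?A)"
    then have sub: "C \<subseteq> ?A" and tot: "\<And>q q'. q \<in> C \<Longrightarrow> q' \<in> C \<Longrightarrow> ?P q q' \<or> ?P q' q"
      by (auto simp: Chains_def relation_of_def)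
    show "\<exists>u\<in>?A. \<forall>a\<in>C. ?P a u"
    proof (cases "C = {}")
      case False
      let ?\<Phi> = "\<lambda>x. (\<lambda>q. q x) ` C"
      have low: "- p (- x) \<le> q x" if "q \<in> C" for q x
        using sublinear_minus[of q x] that sub by (smt (verit) mem_Collect_eq subsetD)
      have bdd: "bdd_below (?\<Phi> x)" for x
        using low by (auto intro!: bdd_belowI2)
      have "sublinear (\<lambda>x. Inf (?\<Phi> x))"
      proof (rule sublinear_Inf)
        fix a b x y assume "a \<in> ?\<Phi> x" "b \<in> ?\<Phi> y"
        then obtain q q' where q: "q \<in> C" "q' \<in> C" "a = q x" "b = q' y" by auto
        then obtain m where m: "m \<in> C" "m x \<le> q x" "m y \<le> q' y"
          using tot[OF q(1,2)] by auto
        moreover have "m (x + y) \<le> m x + m y" using sub m by (auto intro: sublinear_add)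
        ultimately show "\<exists>c\<in>?\<Phi> (x + y). c \<le> a + b" using q
          by (intro bexI[where x="m (x + y)"]) auto
      next
        fix r a x assume "(0::real) < r" "a \<in> ?\<Phi> x"
        then show "\<exists>c\<in>?\<Phi> (r *\<^sub>R x). c \<le> r * a" using sub by (auto intro!: sublinear_scale_le)
      qed (use bdd False in auto)
      moreover have le: "Inf (?\<Phi> x) \<le> q x" if "q \<in> C" for q x
        using bdd that by (intro cInf_lower) auto
      moreover have "Inf (?\<Phi> x) \<le> p x" for x
      proof -
        obtain q where "q \<in> C" using False by blast
        then show ?thesis using le[of q x] sub by (auto intro: order_trans)
      qed
      ultimately show ?thesis by (intro bexI[where x="\<lambda>x. Inf (?\<Phi> x)"]) auto
    qed (use p in auto)
  qed
  then obtain m where m: "sublinear m" "\<And>x. m x \<le> p x"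
    and min: "\<And>q. sublinear q \<Longrightarrow> (\<And>x. q x \<le> p x) \<Longrightarrow> (\<And>x. q x \<le> m x) \<Longrightarrow> q = m"
    by blast
  have neg: "m (- y) = - m y" for y
  proof -
    obtain q where q: "sublinear q" "\<And>x. q x \<le> m x" "q (- y) \<le> - m y"
      using sublinear_tilt[OF m(1)] by blast
    then have "q = m" using m(2) by (intro min) (auto intro: order_trans)
    then show ?thesis using q(3) sublinear_minus[OF m(1), of y] by simp
  qed
  have "linear m"
  proof
    fix x y show "m (x + y) = m x + m y"
      using sublinear_add[OF m(1), of x y] sublinear_add[OF m(1), of "- x" "- y"] neg[of "x + y"] by (simp add: neg)
  next
    fix r x show "m (r *\<^sub>R x) = r *\<^sub>R m x"
    proof (cases "0 \<le> r")
      case True then show ?thesis by (simp add: sublinear_scale[OF m(1)])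
    next
      case False
      then have "m ((- r) *\<^sub>R x) = - r * m x" by (intro sublinear_scale[OF m(1)]) simp
      then show ?thesis by (simp add: neg)
    qed
  qed
  with m(2) show ?thesis by blast
qed

text \<open>
  A linear functional below the tilt of \<open>p\<close> along \<open>y\<close> is at most \<open>- p y\<close> at \<open>- y\<close>, hence at
  least \<open>p y\<close> at \<open>y\<close>.
\<close>

theorem Hahn_Banach:
  assumes p: "sublinear p"
  shows "\<exists>L. linear L \<and> (\<forall>x. L x \<le> p x) \<and> L y = p y"
proof -
  obtain q where q: "sublinear q" "\<And>x. q x \<le> p x" "q (- y) \<le> - p y"
    using sublinear_tilt[OF p] by blast
  obtain L where L: "linear L" "\<And>x. L x \<le> q x"
    using sublinear_dominates_linear[OF q(1)] by blast
  have "L y = p y"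
    using L(2)[of "- y"] L(2)[of y] q(2)[of y] q(3) linear_neg[OF L(1), of y] by simp
  then show ?thesis using L q(2) by (blast intro: order_trans)
qed

lemma Hahn_Banach_blinfun:
  fixes p :: "'a::real_normed_vector \<Rightarrow> real"
  assumes p: "sublinear p" and le: "\<And>x. p x \<le> K * norm x" and K: "0 \<le> K"
  shows "\<exists>\<phi> :: 'a \<Rightarrow>\<^sub>L real. (\<forall>x. blinfun_apply \<phi> x \<le> p x) \<and> blinfun_apply \<phi> y = p y \<and> norm \<phi> \<le> K"
proof -
  obtain L where L: "linear L" "\<And>x. L x \<le> p x" "L y = p y"
    using Hahn_Banach[OF p] by blast
  have bd: "\<bar>L x\<bar> \<le> K * norm x" for x
    using L(2)[of x] le[of x] L(2)[of "- x"] le[of "- x"] linear_neg[OF L(1), of x] by (simp add: abs_le_iff)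
  then have "bounded_linear L"
    using L(1) by (intro bounded_linear.intro bounded_linear_axioms.intro)
      (auto intro!: exI[of _ K] simp: mult.commute)
  then have "blinfun_apply (Blinfun L) = L" by (rule bounded_linear_Blinfun_apply)
  then show ?thesis using L bd K
    by (intro exI[of _ "Blinfun L"]) (auto intro!: norm_blinfun_bound)
qed

lemma sublinear_norm: "sublinear norm"
  by (auto simp: sublinear_def norm_triangle_ineq)

lemma norming_functional:
  fixes x :: "'a::real_normed_vector"
  shows "\<exists>\<phi> :: 'a \<Rightarrow>\<^sub>L real. norm \<phi> \<le> 1 \<and> blinfun_apply \<phi> x = norm x"
  using Hahn_Banach_blinfun[OF sublinear_norm, of 1 x] by auto

lemma sublinear_infdist:
  fixes M :: "'a::real_normed_vector set"
  assumes M: "subspace M"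
  shows "sublinear (\<lambda>x. infdist x M)"
proof -
  have ne: "M \<noteq> {}" using M by (auto simp: subspace_def)
  have eq: "infdist x M = Inf ((\<lambda>m. dist x m) ` M)" for x
    using ne by (simp add: infdist_def)
  show ?thesis unfolding eq
  proof (rule sublinear_Inf)
    fix a b x y assume "a \<in> dist x ` M" "b \<in> dist y ` M"
    then obtain m m' where m: "m \<in> M" "m' \<in> M" "a = dist x m" "b = dist y m'" by auto
    then have "m + m' \<in> M" using M by (simp add: subspace_add)
    then show "\<exists>c\<in>dist (x + y) ` M. c \<le> a + b"
      using m(3,4) by (auto intro!: bexI[of _ "dist (x + y) (m + m')"] dist_triangle_add)
  next
    fix r a x assume "(0::real) < r" "a \<in> dist x ` M"
    then obtain m where m: "m \<in> M" "a = dist x m" by auto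
    then have "r *\<^sub>R m \<in> M" using M by (simp add: subspace_scale)
    moreover have "dist (r *\<^sub>R x) (r *\<^sub>R m) = r * a"
      using m \<open>0 < r\<close> by (simp add: dist_norm flip: scaleR_diff_right)
    ultimately show "\<exists>c\<in>dist (r *\<^sub>R x) ` M. c \<le> r * a" by (metis image_eqI order_refl)
  qed (use ne in \<open>auto intro!: bdd_belowI2[of _ 0]\<close>)
qed

text \<open>
  The distance to \<open>M\<close> is sublinear, vanishes on \<open>M\<close> and is dominated by the norm.
\<close>

lemma separating_functional:
  fixes M :: "'a::real_normed_vector set"
  assumes M: "subspace M" "closed M" and x: "x \<notin> M"
  shows "\<exists>\<phi> :: 'a \<Rightarrow>\<^sub>L real. (\<forall>m\<in>M. blinfun_apply \<phi> m = 0) \<and> blinfun_apply \<phi> x > 0"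
proof -
  have ne: "M \<noteq> {}" and 0: "0 \<in> M" using M by (auto simp: subspace_def)
  have le: "infdist y M \<le> 1 * norm y" for y
    using infdist_le[OF 0, of y] by simp
  obtain \<phi> :: "'a \<Rightarrow>\<^sub>L real" where \<phi>: "\<And>y. blinfun_apply \<phi> y \<le> infdist y M" "blinfun_apply \<phi> x = infdist x M"
    using Hahn_Banach_blinfun[OF sublinear_infdist[OF M(1)] le, of x] by auto
  have "blinfun_apply \<phi> m = 0" if "m \<in> M" for m
    using \<phi>(1)[of m] \<phi>(1)[of "- m"] that subspace_neg[OF M(1) that] by (simp add: blinfun.minus_right)
  moreover have "infdist x M > 0"
    using M(2) x ne by (metis in_closed_iff_infdist_zero infdist_nonneg less_eq_real_def)
  ultimately show ?thesis using \<phi>(2) by (intro exI[of _ \<phi>]) simp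
qed

section \<open>Convex blocks that cannot attain their supremum\<close>

text \<open>
  The weights \<open>B i - B (i + 1)\<close> telescope, so the blocks from \<open>n\<close> to \<open>m\<close> and the remainder
  \<open>B m k\<close> add up to \<open>B n\<close> times a convex combination of members of \<open>K n\<close>. This is why the greedy choices of
  \<open>no_attained_limit\<close> stay comparable at all later stages.
\<close>

lemma telescoped_tail_absorb:
  fixes g :: "nat \<Rightarrow> 'v::real_vector"
  assumes K: "\<And>n. convex (K n)" "\<And>n. K (Suc n) \<subseteq> K n" and g: "\<And>n. g n \<in> K n"
    and B: "\<And>n. 0 < B n" "\<And>n. B (Suc n) \<le> (B n :: real)"
    and "n \<le> m" "k \<in> K m"
  shows "\<exists>k'\<in>K n. (\<Sum>i<m. (B i - B (Suc i)) *\<^sub>R g i) + B m *\<^sub>R k =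
    (\<Sum>i<n. (B i - B (Suc i)) *\<^sub>R g i) + B n *\<^sub>R k'"
  using \<open>n \<le> m\<close> \<open>k \<in> K m\<close>
proof (induction m arbitrary: k rule: dec_induct)
  case base
  then show ?case by auto
next
  case (step m)
  let ?t = "B (Suc m) / B m"
  have "(1 - ?t) *\<^sub>R g m + ?t *\<^sub>R k \<in> K m"
    using K(1)[of m] g[of m] step.prems K(2)[of m] B(1)[of m] B(1)[of "Suc m"] B(2)[of m]
    by (intro convexD) (auto simp: field_simps)
  from step.IH[OF this] obtain k' where k': "k' \<in> K n"
    "(\<Sum>i<m. (B i - B (Suc i)) *\<^sub>R g i) + B m *\<^sub>R ((1 - ?t) *\<^sub>R g m + ?t *\<^sub>R k) =
     (\<Sum>i<n. (B i - B (Suc i)) *\<^sub>R g i) + B n *\<^sub>R k'" by blast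
  have "B m *\<^sub>R ((1 - ?t) *\<^sub>R g m + ?t *\<^sub>R k) = (B m - B (Suc m)) *\<^sub>R g m + B (Suc m) *\<^sub>R k"
    using B(1)[of m] by (simp add: scaleR_add_right right_diff_distrib)
  with k' show ?case by (auto simp: add.assoc intro!: bexI[of _ k'])
qed

text \<open>
  Write \<open>\<sigma>\<close> for the supremum over \<open>W\<close>. By stability \<open>q u = \<sigma> (u - w)\<close> does not depend on \<open>w\<close>.
  The block \<open>g n\<close> is chosen so that \<open>u n = h n + B n g n\<close> almost minimises \<open>q\<close>, where \<open>h n\<close> is the
  weighted sum of the earlier blocks. Since all later \<open>u m\<close> compete in this minimisation,
  \<open>q (u n)\<close> is at most \<open>q H + \<epsilon> n\<close>, where \<open>H\<close> is the limit of the \<open>h n\<close>. Convexity of \<open>\<sigma>\<close> turns this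
  into a bound on the partial sums that misses the value \<open>\<alpha> = \<sigma> (H - w)\<close> by at least
  \<open>B n \<alpha> / 2\<close>. At a point where \<open>H - w\<close> attains \<open>\<alpha>\<close>, the remaining terms must make up for this,
  and since the weights decay fast, the \<open>n\<close>-th term alone must do so. Thus \<open>g n - w\<close> is
  bounded below by a positive constant there for all large \<open>n\<close>, although \<open>w\<close> is a cluster point
  of the \<open>g n\<close>.
\<close>

theorem no_attained_limit:
  fixes ev :: "'w \<Rightarrow> 'v::banach \<Rightarrow> real" and f :: "nat \<Rightarrow> 'v"
  assumes W: "W \<noteq> {}"
    and lin: "\<And>x. x \<in> W \<Longrightarrow> linear (ev x)"
    and bound: "\<And>x v. x \<in> W \<Longrightarrow> \<bar>ev x v\<bar> \<le> M * norm v"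
    and R: "\<And>n. norm (f n) \<le> R"
    and cluster: "\<And>g. (\<And>n. g n \<in> convex hull (f ` {n..})) \<Longrightarrow>
      \<exists>w\<in>\<Lambda>. \<forall>x\<in>W. \<forall>e>0. \<exists>\<^sub>F n in sequentially. ev x (g n) < ev x w + e"
    and stable: "\<And>w w' u. w \<in> \<Lambda> \<Longrightarrow> w' \<in> \<Lambda> \<Longrightarrow> u \<in> convex hull (range f) \<Longrightarrow>
      (SUP x\<in>W. ev x (u - w)) = (SUP x\<in>W. ev x (u - w'))"
    and gap: "0 < \<theta>" "\<And>w u. w \<in> \<Lambda> \<Longrightarrow> u \<in> convex hull (range f) \<Longrightarrow> \<exists>x\<in>W. \<theta> \<le> ev x (u - w)"
    and attain: "\<And>w h. w \<in> \<Lambda> \<Longrightarrow> h \<in> closure (convex hull (range f)) \<Longrightarrow>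
      \<exists>x\<in>W. \<forall>y\<in>W. ev y (h - w) \<le> ev x (h - w)"
  shows False
proof -
  define \<sigma> where "\<sigma> v = (SUP x\<in>W. ev x v)" for v
  have bdd: "bdd_above ((\<lambda>x. ev x v) ` W)" for v
    using bound by (intro bdd_aboveI2[where M="M * norm v"]) (simp add: abs_le_iff)
  have \<sigma>_ge: "ev x v \<le> \<sigma> v" if "x \<in> W" for x v
    unfolding \<sigma>_def using that bdd by (rule cSUP_upper)
  have \<sigma>_le: "\<sigma> v \<le> c" if "\<And>x. x \<in> W \<Longrightarrow> ev x v \<le> c" for v c
    unfolding \<sigma>_def using W that by (rule cSUP_least)
  have \<sigma>_add: "\<sigma> (u + v) \<le> \<sigma> u + \<sigma> v" for u v
    by (rule \<sigma>_le) (auto simp: linear_add[OF lin] intro!: add_mono \<sigma>_ge)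
  have \<sigma>_scale: "\<sigma> (r *\<^sub>R v) \<le> r * \<sigma> v" if "0 \<le> r" for r v
    using that by (intro \<sigma>_le) (auto simp: linear_scale[OF lin] intro!: mult_left_mono \<sigma>_ge)
  have \<sigma>_norm: "\<sigma> v \<le> M * norm v" for v
    using bound by (intro \<sigma>_le) (simp add: abs_le_iff)
  have \<sigma>_lip: "\<sigma> u - \<sigma> v \<le> M * norm (u - v)" for u v
    using \<sigma>_add[of v "u - v"] \<sigma>_norm[of "u - v"] by simp
  have \<sigma>_tendsto: "((\<lambda>n. \<sigma> (s n)) \<longlongrightarrow> \<sigma> l) sequentially" if s: "s \<longlonglongrightarrow> l" for s :: "nat \<Rightarrow> 'v" and l
  proof (rule LIM_zero_cancel, rule Lim_null_comparison)
    show "\<forall>\<^sub>F n in sequentially. norm (\<sigma> (s n) - \<sigma> l) \<le> M * norm (s n - l)"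
    proof (intro always_eventually allI)
      fix n
      show "norm (\<sigma> (s n) - \<sigma> l) \<le> M * norm (s n - l)"
        using \<sigma>_lip[of "s n" l] \<sigma>_lip[of l "s n"] norm_minus_commute[of l "s n"] by (simp add: abs_le_iff)
    qed
    show "(\<lambda>n. M * norm (s n - l)) \<longlonglongrightarrow> 0"
      using s by (intro tendsto_mult_right_zero tendsto_norm_zero LIM_zero)
  qed

  define K where "K n = convex hull (f ` {n..})" for n
  have K: "convex (K n)" "K (Suc n) \<subseteq> K n" "K n \<noteq> {}" for n
    by (auto simp: K_def intro!: hull_mono)
  have K_ball: "norm k \<le> R" if "k \<in> K n" for k n
  proof -
    have "K n \<subseteq> cball 0 R" unfolding K_def using R by (intro hull_minimal) auto
    with that show ?thesis by auto
  qed
  have K0: "K 0 = convex hull (range f)" by (simp add: K_def)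

  \<comment> \<open>Remainders of the weights \<open>\<beta>\<close>: the weights sum to 1, and each remainder is negligible
    compared with the weight before it.\<close>
  define B :: "nat \<Rightarrow> real" where "B n = 1 / fact (Suc n)" for n
  have B: "0 < B n" "B (Suc n) < B n" for n
    by (auto simp: B_def field_simps fact_less_mono simp del: fact_Suc)
  have B_Suc: "B (Suc n) = B n / (real n + 2)" for n
    by (simp add: B_def field_simps)
  have B0: "B 0 = 1" by (simp add: B_def)
  define \<beta> where "\<beta> n = B n - B (Suc n)" for n
  have \<beta>: "0 < \<beta> n" "\<beta> n \<le> B n" for n using B[of n] B(1)[of "Suc n"] by (auto simp: \<beta>_def)
  have B_lim: "B \<longlonglongrightarrow> 0"
  proof -
    have "(\<lambda>n. 1 / fact n :: real) \<longlonglongrightarrow> 0"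
      using summable_LIMSEQ_zero[OF summable_exp[of "1::real"]] by (simp add: divide_inverse)
    then show ?thesis unfolding B_def by (rule LIMSEQ_Suc)
  qed
  have \<beta>_sums: "summable \<beta>"
    using telescope_summable'[OF B_lim] unfolding \<beta>_def[abs_def] .

  obtain w0 where w0: "w0 \<in> \<Lambda>"
    using cluster[of f] by (auto simp: hull_inc)
  define q where "q u = \<sigma> (u - w0)" for u
  have q_low: "\<theta> \<le> q u" if "u \<in> K 0" for u
    using gap(2)[OF w0, of u] that \<sigma>_ge unfolding q_def K0 by (meson order_trans)
  \<comment> \<open>Summable even after division by \<open>B (Suc n)\<close>, with total at most \<open>\<theta> / 2\<close>; see \<open>partial\<close>.\<close>
  define \<epsilon> where "\<epsilon> n = \<theta> / 2 ^ (n + 2) * B (Suc n)" for n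
  have \<epsilon>: "0 < \<epsilon> n" for n using gap(1) B(1) by (simp add: \<epsilon>_def)

  have step: "\<exists>k\<in>K n. \<forall>k'\<in>K n. q (h + B n *\<^sub>R k) \<le> q (h + B n *\<^sub>R k') + \<epsilon> n" for n h
  proof -
    let ?A = "(\<lambda>k. q (h + B n *\<^sub>R k)) ` K n"
    have bdd_A: "bdd_below ?A"
    proof (rule bdd_belowI2)
      fix k assume k: "k \<in> K n"
      obtain x where x: "x \<in> W" using W by blast
      have "norm (h + B n *\<^sub>R k - w0) \<le> norm (h - w0) + norm (B n *\<^sub>R k)"
        by (metis add_diff_eq add.commute norm_triangle_ineq)
      also have "\<dots> \<le> norm (h - w0) + B n * R" using K_ball[OF k] B(1)[of n] by simp
      finally have "M * norm (h + B n *\<^sub>R k - w0) \<le> \<bar>M\<bar> * (norm (h - w0) + B n * R)"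
        by (intro mult_mono) auto
      then show "- (\<bar>M\<bar> * (norm (h - w0) + B n * R)) \<le> q (h + B n *\<^sub>R k)"
        using \<sigma>_ge[OF x, of "h + B n *\<^sub>R k - w0"] bound[OF x, of "h + B n *\<^sub>R k - w0"] unfolding q_def by linarith
    qed
    obtain k where k: "k \<in> K n" "q (h + B n *\<^sub>R k) < Inf ?A + \<epsilon> n"
      using cInf_lessD[of ?A "Inf ?A + \<epsilon> n"] K(3)[of n] \<epsilon>[of n] by auto
    have "q (h + B n *\<^sub>R k) \<le> q (h + B n *\<^sub>R k') + \<epsilon> n" if "k' \<in> K n" for k'
      using cInf_lower[OF imageI[OF that] bdd_A] k(2) by linarith
    with k(1) show ?thesis by blast
  qed
  obtain pick where pick: "\<And>n h. pick n h \<in> K n"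
    "\<And>n h k. k \<in> K n \<Longrightarrow> q (h + B n *\<^sub>R pick n h) \<le> q (h + B n *\<^sub>R k) + \<epsilon> n"
    using step by metis
  define h where "h = rec_nat 0 (\<lambda>n h. h + \<beta> n *\<^sub>R pick n h)"
  define g where "g n = pick n (h n)" for n
  have h_Suc: "h (Suc n) = h n + \<beta> n *\<^sub>R g n" and h_0: "h 0 = 0" for n
    by (simp_all add: h_def g_def)
  have h_sum: "h n = (\<Sum>i<n. (B i - B (Suc i)) *\<^sub>R g i)" for n
    by (induction n) (simp_all add: h_0 h_Suc \<beta>_def)
  have g: "g n \<in> K n" and g_min: "\<And>k. k \<in> K n \<Longrightarrow> q (h n + B n *\<^sub>R g n) \<le> q (h n + B n *\<^sub>R k) + \<epsilon> n" for n
    unfolding g_def using pick by blast+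

  define u where "u n = h n + B n *\<^sub>R g n" for n
  have u_tail: "\<exists>k\<in>K n. u m = h n + B n *\<^sub>R k" if "n \<le> m" for n m
    using telescoped_tail_absorb[of K g B n m "g m"] K g B(1) less_imp_le[OF B(2)] that
    unfolding u_def h_sum by blast
  have u_K0: "u n \<in> K 0" for n using u_tail[of 0 n] by (auto simp: h_0 B0)
  have "summable (\<lambda>n. \<beta> n *\<^sub>R g n)"
  proof (rule summable_comparison_test')
    show "summable (\<lambda>n. \<beta> n * R)" using \<beta>_sums by (rule summable_mult2)
    show "norm (\<beta> n *\<^sub>R g n) \<le> \<beta> n * R" if "0 \<le> n" for n
      using \<beta>(1)[of n] K_ball[OF g[of n]] by simp
  qed
  then obtain H where H: "h \<longlonglongrightarrow> H"
    unfolding h_sum by (auto simp: summable_def sums_def \<beta>_def)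
  have u_lim: "u \<longlonglongrightarrow> H"
  proof -
    have "(\<lambda>n. B n *\<^sub>R g n) \<longlonglongrightarrow> 0"
    proof (rule Lim_null_comparison)
      show "\<forall>\<^sub>F n in sequentially. norm (B n *\<^sub>R g n) \<le> B n * R"
        using B(1) K_ball[OF g] by (intro always_eventually) (simp add: less_imp_le)
      show "(\<lambda>n. B n * R) \<longlonglongrightarrow> 0" using B_lim by (rule tendsto_mult_left_zero)
    qed
    from tendsto_add[OF H this] show ?thesis by (simp add: u_def[abs_def])
  qed
  have H_cl: "H \<in> closure (convex hull (range f))"
    unfolding closure_sequential using u_lim u_K0 by (auto simp: K0)
  have H_tail: "norm (H - h n) \<le> B n * R" for n
  proof (rule Lim_bounded)
    show "(\<lambda>m. norm (u m - h n)) \<longlonglongrightarrow> norm (H - h n)"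
      using u_lim by (intro tendsto_intros)
    show "\<forall>m\<ge>n. norm (u m - h n) \<le> B n * R"
      using u_tail[of n] K_ball B(1)[of n] by fastforce
  qed
  define \<alpha> where "\<alpha> = q H"
  have q_lim: "(\<lambda>m. q (u m)) \<longlonglongrightarrow> \<alpha>"
    unfolding q_def \<alpha>_def using u_lim by (intro \<sigma>_tendsto tendsto_intros)
  have \<alpha>_ge: "\<theta> \<le> \<alpha>"
    by (rule Lim_bounded2[OF q_lim, of 0]) (use q_low u_K0 in auto)
  have q_u: "q (u n) \<le> \<alpha> + \<epsilon> n" for n
  proof -
    have "q (u n) - \<epsilon> n \<le> \<alpha>"
    proof (rule Lim_bounded2[OF q_lim, of n], intro allI impI)
      fix m assume "m \<ge> n"
      then obtain k where "k \<in> K n" "u m = h n + B n *\<^sub>R k" using u_tail by blast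
      then show "q (u n) - \<epsilon> n \<le> q (u m)" using g_min[of k n] by (simp add: u_def)
    qed
    then show ?thesis by simp
  qed

  obtain w where w: "w \<in> \<Lambda>"
    and w_cl: "\<And>x e. x \<in> W \<Longrightarrow> 0 < e \<Longrightarrow> \<exists>\<^sub>F n in sequentially. ev x (g n) < ev x w + e"
    using cluster[of g] g unfolding K_def by blast
  have \<sigma>_w: "\<sigma> (v - w) = q v" if "v \<in> K 0" for v
    using stable[OF w w0, of v] that unfolding \<sigma>_def q_def K0 by simp
  have \<sigma>_Hw: "\<sigma> (H - w) = \<alpha>"
  proof (rule LIMSEQ_unique)
    show "(\<lambda>n. \<sigma> (u n - w)) \<longlonglongrightarrow> \<sigma> (H - w)"
      using u_lim by (intro \<sigma>_tendsto tendsto_intros)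
    show "(\<lambda>n. \<sigma> (u n - w)) \<longlonglongrightarrow> \<alpha>" using q_lim \<sigma>_w[OF u_K0] by simp
  qed
  have partial: "\<sigma> (h n - (1 - B n) *\<^sub>R w) \<le> \<alpha> * (1 - B n) + B n * (\<theta> / 2 * (1 - 1 / 2 ^ n))" for n
  proof (induction n)
    case 0
    then show ?case using \<sigma>_norm[of 0] by (simp add: h_0 B0)
  next
    case (Suc n)
    let ?s = "B (Suc n) / B n" and ?t = "\<beta> n / B n"
    have st: "?s + ?t = 1" "0 \<le> ?s" "0 \<le> ?t" "?t \<le> 1" "?s * B n = B (Suc n)"
      using B(1)[of n] B(1)[of "Suc n"] B(2)[of n] by (auto simp: \<beta>_def field_simps)
    \<comment> \<open>The weights of \<open>h n\<close> add up to \<open>1 - B n\<close>, so this is the multiple of \<open>w\<close> that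
      makes the next difference a convex combination of the previous one and of \<open>u n - w\<close>.\<close>
    have "h (Suc n) - (1 - B (Suc n)) *\<^sub>R w =
        ?s *\<^sub>R (h n - (1 - B n) *\<^sub>R w) + ?t *\<^sub>R (u n - w)"
    proof -
      have "?s *\<^sub>R (h n - (1 - B n) *\<^sub>R w) + ?t *\<^sub>R (u n - w) =
         (?s + ?t) *\<^sub>R h n + (?t * B n) *\<^sub>R g n - (?s + ?t - ?s * B n) *\<^sub>R w"
        by (simp add: u_def algebra_simps)
      then show ?thesis using st B(1)[of n] by (simp add: h_Suc)
    qed
    then have "\<sigma> (h (Suc n) - (1 - B (Suc n)) *\<^sub>R w) \<le>
        ?s * \<sigma> (h n - (1 - B n) *\<^sub>R w) + ?t * \<sigma> (u n - w)"
      using \<sigma>_add[of "?s *\<^sub>R (h n - (1 - B n) *\<^sub>R w)" "?t *\<^sub>R (u n - w)"]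
        \<sigma>_scale[OF st(2), of "h n - (1 - B n) *\<^sub>R w"] \<sigma>_scale[OF st(3), of "u n - w"] by simp
    also have "\<dots> \<le> ?s * (\<alpha> * (1 - B n) + B n * (\<theta> / 2 * (1 - 1 / 2 ^ n))) + ?t * (\<alpha> + \<epsilon> n)"
      using Suc st q_u[of n] \<sigma>_w[OF u_K0, of n] by (intro add_mono mult_left_mono) auto
    also have "\<dots> = \<alpha> * (?s + ?t - ?s * B n) + (?s * B n) * (\<theta> / 2 * (1 - 1 / 2 ^ n)) + ?t * \<epsilon> n"
      by (simp only: algebra_simps)
    also have "\<dots> = \<alpha> * (1 - B (Suc n)) + B (Suc n) * (\<theta> / 2 * (1 - 1 / 2 ^ n)) + ?t * \<epsilon> n"
      unfolding st(1,5) ..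
    also have "\<dots> \<le> \<alpha> * (1 - B (Suc n)) + B (Suc n) * (\<theta> / 2 * (1 - 1 / 2 ^ n)) + 1 * \<epsilon> n"
      using st(4) \<epsilon>[of n] by (intro add_left_mono mult_right_mono) auto
    also have "\<dots> = \<alpha> * (1 - B (Suc n)) + B (Suc n) * (\<theta> / 2 * (1 - 1 / 2 ^ Suc n))"
      by (simp add: \<epsilon>_def field_simps)
    finally show ?case .
  qed

  obtain x where x: "x \<in> W" and x_max: "\<And>y. y \<in> W \<Longrightarrow> ev y (H - w) \<le> ev x (H - w)"
    using attain[OF w H_cl] by blast
  have ev_x: "ev x (H - w) = \<alpha>"
    using \<sigma>_le[of "H - w" "ev x (H - w)"] \<sigma>_ge[OF x, of "H - w"] x_max \<sigma>_Hw by auto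
  have lower: "B n * (\<theta> / 2) - \<bar>M\<bar> * (B (Suc n) * (R + norm w)) \<le> \<beta> n * (ev x (g n) - ev x w)" for n
  proof -
    have dec: "H - w = (h n - (1 - B n) *\<^sub>R w) + \<beta> n *\<^sub>R (g n - w) + (H - h (Suc n) - B (Suc n) *\<^sub>R w)"
      by (simp add: h_Suc \<beta>_def algebra_simps)
    have "\<alpha> = ev x (h n - (1 - B n) *\<^sub>R w) + \<beta> n * (ev x (g n) - ev x w) + ev x (H - h (Suc n) - B (Suc n) *\<^sub>R w)"
      unfolding ev_x[symmetric] by (subst dec) (simp only: linear_add[OF lin[OF x]] linear_scale[OF lin[OF x]] linear_diff[OF lin[OF x]] real_scaleR_def)
    moreover have "ev x (h n - (1 - B n) *\<^sub>R w) \<le> \<alpha> * (1 - B n) + B n * (\<theta> / 2)"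
    proof -
      have "B n * (\<theta> / 2 * (1 - 1 / 2 ^ n)) \<le> B n * (\<theta> / 2)"
        using B(1)[of n] gap(1) by (intro mult_left_mono mult_left_le) auto
      then show ?thesis using \<sigma>_ge[OF x, of "h n - (1 - B n) *\<^sub>R w"] partial[of n] by linarith
    qed
    moreover have "ev x (H - h (Suc n) - B (Suc n) *\<^sub>R w) \<le> \<bar>M\<bar> * (B (Suc n) * (R + norm w))"
    proof -
      have "norm (H - h (Suc n) - B (Suc n) *\<^sub>R w) \<le> norm (H - h (Suc n)) + norm (B (Suc n) *\<^sub>R w)"
        by (rule norm_triangle_ineq4)
      also have "\<dots> \<le> B (Suc n) * (R + norm w)"
        using H_tail[of "Suc n"] B(1)[of "Suc n"] by (simp add: algebra_simps)
      finally have "M * norm (H - h (Suc n) - B (Suc n) *\<^sub>R w) \<le> \<bar>M\<bar> * (B (Suc n) * (R + norm w))"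
        by (intro mult_mono) auto
      then show ?thesis using bound[OF x, of "H - h (Suc n) - B (Suc n) *\<^sub>R w"] by linarith
    qed
    moreover have "B n * \<theta> \<le> B n * \<alpha>" using \<alpha>_ge B(1)[of n] by simp
    ultimately show ?thesis by (simp add: algebra_simps)
  qed
  have "\<forall>\<^sub>F n in sequentially. ev x w + \<theta> / 4 \<le> ev x (g n)"
  proof -
    have "(\<lambda>n. \<bar>M\<bar> * (R + norm w) / (real n + 2)) \<longlonglongrightarrow> 0"
      using LIMSEQ_ignore_initial_segment[OF lim_const_over_n[of "\<bar>M\<bar> * (R + norm w)"], of 2] by (simp add: add.commute)
    then have "\<forall>\<^sub>F n in sequentially. \<bar>M\<bar> * (R + norm w) / (real n + 2) < \<theta> / 4"
      using gap(1) by (intro order_tendstoD(2)) auto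
    then show ?thesis
    proof eventually_elim
      case (elim n)
      have "\<bar>M\<bar> * (B (Suc n) * (R + norm w)) = B n * (\<bar>M\<bar> * (R + norm w) / (real n + 2))"
        by (simp add: B_Suc)
      also have "\<dots> \<le> B n * (\<theta> / 4)" using elim B(1)[of n] by (intro mult_left_mono) auto
      finally have "B n * (\<theta> / 4) \<le> \<beta> n * (ev x (g n) - ev x w)"
        using lower[of n] by (simp add: field_simps)
      moreover have "\<beta> n * (\<theta> / 4) \<le> B n * (\<theta> / 4)" using \<beta>(2)[of n] gap(1) by (intro mult_right_mono) auto
      ultimately have "\<beta> n * (\<theta> / 4) \<le> \<beta> n * (ev x (g n) - ev x w)" by linarith
      then show ?case using \<beta>(1)[of n] by simp
    qed
  qed
  moreover have "\<exists>\<^sub>F n in sequentially. ev x (g n) < ev x w + \<theta> / 4"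
    using w_cl[OF x] gap(1) by simp
  ultimately show False
    by (auto simp: frequently_def not_less)
qed

section \<open>James's theorem\<close>

text \<open>
  By induction on \<open>A\<close>: one functional that vanishes on \<open>A\<close> but not at a new point \<open>a\<close> determines the
  multiple of evaluation at \<open>a\<close> to be subtracted from \<open>G\<close>.
\<close>

lemma functional_vanishing_on_annihilator:
  fixes G :: "('a::real_normed_vector \<Rightarrow>\<^sub>L real) \<Rightarrow> real"
  assumes "finite A" "linear G" "\<And>\<phi>. (\<forall>a\<in>A. blinfun_apply \<phi> a = 0) \<Longrightarrow> G \<phi> = 0"
  shows "\<exists>x. \<forall>\<phi>. G \<phi> = blinfun_apply \<phi> x"
  using assms
proof (induction A arbitrary: G rule: finite_induct)
  case empty
  then show ?case by (intro exI[of _ 0]) auto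
next
  case (insert a A)
  show ?case
  proof (cases "\<exists>\<psi> :: 'a \<Rightarrow>\<^sub>L real. (\<forall>b\<in>A. blinfun_apply \<psi> b = 0) \<and> blinfun_apply \<psi> a \<noteq> 0")
    case False
    then have "G \<phi> = 0" if "\<forall>b\<in>A. blinfun_apply \<phi> b = 0" for \<phi>
      using that by (intro insert.prems(2)) blast
    then show ?thesis by (rule insert.IH[OF insert.prems(1)])
  next
    case True
    then obtain \<psi> :: "'a \<Rightarrow>\<^sub>L real" where \<psi>: "\<And>b. b \<in> A \<Longrightarrow> blinfun_apply \<psi> b = 0" "blinfun_apply \<psi> a \<noteq> 0" by blast
    define s where "s = G \<psi> / blinfun_apply \<psi> a"
    have "linear (\<lambda>\<phi>. G \<phi> - s * blinfun_apply \<phi> a)"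
      by (rule linearI) (simp_all add: linear_add[OF insert.prems(1)] linear_scale[OF insert.prems(1)]
          blinfun.add_left blinfun.scaleR_left algebra_simps)
    moreover have "G \<phi> - s * blinfun_apply \<phi> a = 0" if "\<forall>b\<in>A. blinfun_apply \<phi> b = 0" for \<phi>
    proof -
      let ?\<chi> = "\<phi> - (blinfun_apply \<phi> a / blinfun_apply \<psi> a) *\<^sub>R \<psi>"
      have "G ?\<chi> = 0"
        using that \<psi> by (intro insert.prems(2)) (auto simp: blinfun.diff_left blinfun.scaleR_left)
      then show ?thesis
        by (simp add: linear_diff[OF insert.prems(1)] linear_scale[OF insert.prems(1)] s_def)
    qed
    ultimately obtain x where x: "\<And>\<phi>. G \<phi> - s * blinfun_apply \<phi> a = blinfun_apply \<phi> x"
      using insert.IH[of "\<lambda>\<phi>. G \<phi> - s * blinfun_apply \<phi> a"] by blast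
    have "G \<phi> = blinfun_apply \<phi> (x + s *\<^sub>R a)" for \<phi>
      using x[of \<phi>] by (simp add: blinfun.add_right blinfun.scaleR_right)
    then show ?thesis by blast
  qed
qed

text \<open>
  An element of the bidual at distance \<open>0\<close> from the image of the space belongs to it, because the
  canonical embedding is isometric and the space is complete.
\<close>

lemma bidual_gap:
  fixes F :: "('a::banach \<Rightarrow>\<^sub>L real) \<Rightarrow>\<^sub>L real"
  assumes "\<nexists>x. \<forall>\<phi>. blinfun_apply F \<phi> = blinfun_apply \<phi> x"
  shows "\<exists>\<theta>>0. \<forall>x. \<exists>\<phi>. norm \<phi> \<le> 1 \<and> \<theta> < blinfun_apply F \<phi> - blinfun_apply \<phi> x"
proof (rule ccontr)
  assume not: "\<not> ?thesis"
  have "\<exists>x. \<forall>\<phi>. norm \<phi> \<le> 1 \<longrightarrow> blinfun_apply F \<phi> - blinfun_apply \<phi> x \<le> inverse (real (Suc n))" for n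
  proof -
    have "0 < inverse (real (Suc n))" by simp
    with not show ?thesis by (meson not_less)
  qed
  then obtain X where X: "\<And>n \<phi>. norm \<phi> \<le> 1 \<Longrightarrow> blinfun_apply F \<phi> - blinfun_apply \<phi> (X n) \<le> inverse (real (Suc n))"
    by metis
  have X_abs: "\<bar>blinfun_apply F \<phi> - blinfun_apply \<phi> (X n)\<bar> \<le> inverse (real (Suc n))" if "norm \<phi> \<le> 1" for n \<phi>
    using X[OF that, of n] X[of "- \<phi>" n] that by (simp add: blinfun.minus_right blinfun.minus_left abs_le_iff)
  have "Cauchy X"
  proof (rule metric_CauchyI)
    fix e :: real assume "0 < e"
    then obtain N where N: "inverse (real (Suc N)) < e / 2" using reals_Archimedean[of "e / 2"] by auto
    have small: "inverse (real (Suc n)) < e / 2" if "N \<le> n" for n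
    proof -
      have "inverse (real (Suc n)) \<le> inverse (real (Suc N))" using that by (intro le_imp_inverse_le) auto
      then show ?thesis using N by linarith
    qed
    have "dist (X m) (X n) < e" if mn: "N \<le> m" "N \<le> n" for m n
    proof -
      obtain \<phi> :: "'a \<Rightarrow>\<^sub>L real" where \<phi>: "norm \<phi> \<le> 1" "blinfun_apply \<phi> (X m - X n) = norm (X m - X n)"
        using norming_functional by blast
      then show ?thesis
        using X_abs[OF \<phi>(1), of m] X_abs[OF \<phi>(1), of n] small[OF mn(1)] small[OF mn(2)]
        by (simp add: dist_norm blinfun.diff_right abs_le_iff)
    qed
    then show "\<exists>M. \<forall>m\<ge>M. \<forall>n\<ge>M. dist (X m) (X n) < e" by blast
  qed
  then obtain x where x: "X \<longlonglongrightarrow> x" using Cauchy_convergent_iff convergent_def by blast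
  have ball: "blinfun_apply F \<phi> = blinfun_apply \<phi> x" if "norm \<phi> \<le> 1" for \<phi>
  proof -
    have "(\<lambda>n. blinfun_apply \<phi> (X n)) \<longlonglongrightarrow> blinfun_apply F \<phi>"
    proof (rule LIM_zero_cancel, rule Lim_null_comparison)
      show "\<forall>\<^sub>F n in sequentially. norm (blinfun_apply \<phi> (X n) - blinfun_apply F \<phi>) \<le> inverse (real (Suc n))"
        using X_abs[OF that] by (intro always_eventually) (simp add: abs_minus_commute del: of_nat_Suc)
    qed (rule LIMSEQ_inverse_real_of_nat)
    moreover have "(\<lambda>n. blinfun_apply \<phi> (X n)) \<longlonglongrightarrow> blinfun_apply \<phi> x"
      using x by (intro tendsto_intros)
    ultimately show ?thesis by (rule LIMSEQ_unique)
  qed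
  have "blinfun_apply F \<phi> = blinfun_apply \<phi> x" for \<phi>
  proof (cases "\<phi> = 0")
    case False
    have "blinfun_apply F ((1 / norm \<phi>) *\<^sub>R \<phi>) = blinfun_apply ((1 / norm \<phi>) *\<^sub>R \<phi>) x"
      using False by (intro ball) simp
    then show ?thesis using False by (simp add: blinfun.scaleR_right blinfun.scaleR_left)
  qed simp
  with assms show False by blast
qed

text \<open>
  Otherwise \<open>F\<close> is bounded by \<open>\<theta>\<close> times the norm on the annihilator of \<open>A\<close>. Extending this restriction
  with the same bound gives \<open>L\<close>, and \<open>F - L\<close> vanishes on the annihilator, so it is evaluation at
  some \<open>x\<close>. Then \<open>F\<close> is within \<open>\<theta>\<close> of this evaluation, against the gap.
\<close>

lemma Helly_annihilator:
  fixes F :: "('a::real_normed_vector \<Rightarrow>\<^sub>L real) \<Rightarrow>\<^sub>L real"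
  assumes \<theta>: "0 < \<theta>" and gap: "\<And>x. \<exists>\<phi>. norm \<phi> \<le> 1 \<and> \<theta> < blinfun_apply F \<phi> - blinfun_apply \<phi> x"
    and A: "finite A"
  shows "\<exists>\<phi>. norm \<phi> \<le> 1 \<and> \<theta> \<le> blinfun_apply F \<phi> \<and> (\<forall>a\<in>A. blinfun_apply \<phi> a = 0)"
proof (rule ccontr)
  assume not: "\<not> ?thesis"
  define N where "N = {\<phi> :: 'a \<Rightarrow>\<^sub>L real. \<forall>a\<in>A. blinfun_apply \<phi> a = 0}"
  have N: "subspace N"
    by (auto simp: N_def subspace_def blinfun.add_left blinfun.scaleR_left)
  have F_le: "blinfun_apply F m \<le> \<theta> * norm m" if "m \<in> N" for m
  proof (cases "m = 0")
    case False
    have "(1 / norm m) *\<^sub>R m \<in> N" using N that by (rule subspace_scale)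
    then have "blinfun_apply F ((1 / norm m) *\<^sub>R m) < \<theta>"
      using not False unfolding N_def by force
    then show ?thesis using False by (simp add: blinfun.scaleR_right field_simps)
  qed simp
  let ?\<Phi> = "\<lambda>\<phi>. (\<lambda>m. \<theta> * norm (\<phi> - m) + blinfun_apply F m) ` N"
  have bdd: "bdd_below (?\<Phi> \<phi>)" for \<phi>
  proof (rule bdd_belowI2)
    fix m assume m: "m \<in> N"
    have "- blinfun_apply F m \<le> \<theta> * norm m"
      using F_le[OF subspace_neg[OF N m]] by (simp add: blinfun.minus_right)
    also have "\<dots> \<le> \<theta> * (norm \<phi> + norm (\<phi> - m))"
      using \<theta> norm_triangle_ineq4[of \<phi> "\<phi> - m"] by (intro mult_left_mono) auto
    finally show "- \<theta> * norm \<phi> \<le> \<theta> * norm (\<phi> - m) + blinfun_apply F m" by (simp add: algebra_simps)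
  qed
  have sub: "sublinear (\<lambda>\<phi>. Inf (?\<Phi> \<phi>))"
  proof (rule sublinear_Inf)
    fix a b x y assume "a \<in> ?\<Phi> x" "b \<in> ?\<Phi> y"
    then obtain m m' where m: "m \<in> N" "m' \<in> N" "a = \<theta> * norm (x - m) + blinfun_apply F m"
      "b = \<theta> * norm (y - m') + blinfun_apply F m'" by auto
    have "norm (x + y - (m + m')) \<le> norm (x - m) + norm (y - m')"
      by (metis add_diff_add norm_triangle_ineq)
    then have "\<theta> * norm (x + y - (m + m')) \<le> \<theta> * (norm (x - m) + norm (y - m'))"
      using \<theta> by (intro mult_left_mono) auto
    then have "\<theta> * norm (x + y - (m + m')) + blinfun_apply F (m + m') \<le> a + b"
      unfolding m(3,4) by (simp add: blinfun.add_right algebra_simps)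
    then show "\<exists>c\<in>?\<Phi> (x + y). c \<le> a + b" using subspace_add[OF N m(1,2)] by blast
  next
    fix r a x assume r: "(0::real) < r" and "a \<in> ?\<Phi> x"
    then obtain m where m: "m \<in> N" "a = \<theta> * norm (x - m) + blinfun_apply F m" by auto
    have "norm (r *\<^sub>R x - r *\<^sub>R m) = r * norm (x - m)"
      using r by (simp flip: scaleR_diff_right)
    then have "\<theta> * norm (r *\<^sub>R x - r *\<^sub>R m) + blinfun_apply F (r *\<^sub>R m) \<le> r * a"
      by (simp add: m(2) blinfun.scaleR_right algebra_simps)
    then show "\<exists>c\<in>?\<Phi> (r *\<^sub>R x). c \<le> r * a" using subspace_scale[OF N m(1)] by blast
  qed (use bdd subspace_0[OF N] in auto)
  obtain L where L: "linear L" "\<And>\<phi>. L \<phi> \<le> Inf (?\<Phi> \<phi>)"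
    using sublinear_dominates_linear[OF sub] by blast
  have L_N: "L \<phi> \<le> \<theta> * norm (\<phi> - m) + blinfun_apply F m" if "m \<in> N" for m \<phi>
    using L(2)[of \<phi>] cInf_lower[OF imageI[OF that] bdd[of \<phi>]] by (rule order_trans)
  have "linear (\<lambda>\<phi>. blinfun_apply F \<phi> - L \<phi>)"
    by (rule linearI) (simp_all add: linear_add[OF L(1)] linear_scale[OF L(1)] blinfun.add_right blinfun.scaleR_right algebra_simps)
  moreover have "blinfun_apply F \<phi> - L \<phi> = 0" if "\<forall>a\<in>A. blinfun_apply \<phi> a = 0" for \<phi>
  proof -
    have "\<phi> \<in> N" using that by (simp add: N_def)
    then show ?thesis
      using L_N[of \<phi> \<phi>] L_N[of "- \<phi>" "- \<phi>"] subspace_neg[OF N] linear_neg[OF L(1), of \<phi>]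
      by (simp add: blinfun.minus_right)
  qed
  ultimately obtain x where x: "\<And>\<phi>. blinfun_apply F \<phi> - L \<phi> = blinfun_apply \<phi> x"
    using functional_vanishing_on_annihilator[OF A, of "\<lambda>\<phi>. blinfun_apply F \<phi> - L \<phi>"] by blast
  obtain \<phi> where \<phi>: "norm \<phi> \<le> 1" "\<theta> < blinfun_apply F \<phi> - blinfun_apply \<phi> x" using gap by blast
  have "L \<phi> \<le> \<theta> * norm \<phi>" using L_N[OF subspace_0[OF N], of \<phi>] by simp
  also have "\<dots> \<le> \<theta>" using \<phi>(1) \<theta> by (intro mult_left_le) auto
  finally show False using x[of \<phi>] \<phi>(2) by simp
qed

lemma convex_hull_range_initial:
  fixes f :: "nat \<Rightarrow> 'v::real_vector"
  assumes "u \<in> convex hull (range f)"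
  shows "\<exists>n. u \<in> convex hull (f ` {..n})"
proof -
  have "convex hull (range f) \<subseteq> (\<Union>n. convex hull (f ` {..n}))"
  proof (rule hull_minimal)
    show "range f \<subseteq> (\<Union>n. convex hull (f ` {..n}))" by (auto intro!: hull_inc)
    show "convex (\<Union>n. convex hull (f ` {..n}))"
    proof (rule convexI)
      fix x y and s t :: real
      assume st: "0 \<le> s" "0 \<le> t" "s + t = 1" and "x \<in> (\<Union>n. convex hull (f ` {..n}))" "y \<in> (\<Union>n. convex hull (f ` {..n}))"
      then obtain n m where "x \<in> convex hull (f ` {..n})" "y \<in> convex hull (f ` {..m})" by auto
      moreover have "convex hull (f ` {..n}) \<subseteq> convex hull (f ` {..max n m})"
        "convex hull (f ` {..m}) \<subseteq> convex hull (f ` {..max n m})" by (auto intro!: hull_mono)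
      ultimately have "s *\<^sub>R x + t *\<^sub>R y \<in> convex hull (f ` {..max n m})"
        using st by (intro convexD[OF convex_convex_hull]) auto
      then show "s *\<^sub>R x + t *\<^sub>R y \<in> (\<Union>n. convex hull (f ` {..n}))" by blast
    qed
  qed
  with assms show ?thesis by blast
qed

text \<open>
  On convex combinations of functionals with \<open>F \<phi> \<ge> \<theta>\<close> the norm is bounded below, so each of them is
  larger than \<open>\<delta>\<close> somewhere on \<open>W\<close>. The convex hull of finitely many functionals is compact;
  hence finitely many points of \<open>W\<close> serve for it, and the next functional can be chosen to vanish at
  them.
\<close>

lemma James_sequence:
  fixes F :: "('a::real_normed_vector \<Rightarrow>\<^sub>L real) \<Rightarrow>\<^sub>L real" and W :: "'a set"
  assumes c: "0 < c" "\<And>\<phi>. \<exists>x\<in>W. c * norm \<phi> \<le> blinfun_apply \<phi> x"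
    and \<theta>: "0 < \<theta>" and gap: "\<And>x. \<exists>\<phi>. norm \<phi> \<le> 1 \<and> \<theta> < blinfun_apply F \<phi> - blinfun_apply \<phi> x"
  shows "\<exists>(f :: nat \<Rightarrow> 'a \<Rightarrow>\<^sub>L real) \<delta>. 0 < \<delta> \<and> (\<forall>n. norm (f n) \<le> 1) \<and>
    (\<forall>u\<in>convex hull (range f). \<exists>x\<in>W. \<delta> \<le> blinfun_apply u x \<and> (\<forall>\<^sub>F n in sequentially. blinfun_apply (f n) x = 0))"
proof -
  define T where "T = {\<phi>. norm \<phi> \<le> 1 \<and> \<theta> \<le> blinfun_apply F \<phi>}"
  have Helly: "\<exists>\<phi>\<in>T. \<forall>a\<in>A. blinfun_apply \<phi> a = 0" if "finite A" for A
    using Helly_annihilator[OF \<theta> gap that] by (auto simp: T_def)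
  have F_norm: "\<theta> \<le> norm F * norm \<phi>" if "\<theta> \<le> blinfun_apply F \<phi>" for \<phi>
    using norm_blinfun[of F \<phi>] that by simp
  obtain \<phi>0 where "\<phi>0 \<in> T" using Helly[of "{}"] by auto
  then have F_pos: "0 < norm F" using F_norm[of \<phi>0] \<theta> by (auto simp: T_def)
  define \<delta> where "\<delta> = c * \<theta> / (2 * norm F)"
  have \<delta>: "0 < \<delta>" using c(1) \<theta> F_pos by (simp add: \<delta>_def)
  have net: "\<exists>A. finite A \<and> A \<subseteq> W \<and> (\<forall>u\<in>convex hull C. \<exists>x\<in>A. \<delta> \<le> blinfun_apply u x)"
    if C: "finite C" "C \<subseteq> T" for C
  proof -
    have "convex hull C \<subseteq> {\<phi>. \<theta> \<le> blinfun_apply F \<phi>}"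
      using C(2) convex_linear_vimage[of "blinfun_apply F" "{\<theta>..}"]
      by (intro hull_minimal) (auto simp: T_def vimage_def blinfun.bounded_linear_right bounded_linear.linear)
    then have cover: "convex hull C \<subseteq> (\<Union>x\<in>W. {\<phi>. \<delta> < blinfun_apply \<phi> x})"
    proof (intro subsetI)
      fix u assume sub: "convex hull C \<subseteq> {\<phi>. \<theta> \<le> blinfun_apply F \<phi>}" and "u \<in> convex hull C"
      then have "\<theta> / norm F \<le> norm u" using F_norm[of u] F_pos by (auto simp: field_simps)
      then have "c * (\<theta> / norm F) \<le> c * norm u" using c(1) by (intro mult_left_mono) auto
      moreover have "\<delta> < c * (\<theta> / norm F)" using c(1) \<theta> F_pos by (simp add: \<delta>_def field_simps)
      moreover obtain x where "x \<in> W" "c * norm u \<le> blinfun_apply u x" using c(2) by blast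
      ultimately show "u \<in> (\<Union>x\<in>W. {\<phi>. \<delta> < blinfun_apply \<phi> x})" by force
    qed
    have op: "open {\<phi> :: 'a \<Rightarrow>\<^sub>L real. \<delta> < blinfun_apply \<phi> x}" for x
      by (intro open_Collect_less continuous_intros)
    show ?thesis
    proof (rule compactE_image[OF finite_imp_compact_convex_hull[OF C(1)] op cover])
      fix A assume A: "A \<subseteq> W" "finite A" "convex hull C \<subseteq> (\<Union>x\<in>A. {\<phi>. \<delta> < blinfun_apply \<phi> x})"
      have "\<exists>x\<in>A. \<delta> \<le> blinfun_apply u x" if "u \<in> convex hull C" for u
        using A(3) that by (auto dest!: subsetD intro: less_imp_le)
      with A(1,2) show ?thesis by blast
    qed
  qed
  define P where "P = (\<lambda>(C, A, \<phi>). finite C \<and> C \<subseteq> T \<and> \<phi> \<in> C \<and> finite A \<and> A \<subseteq> W \<and>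
     (\<forall>u\<in>convex hull C. \<exists>x\<in>A. \<delta> \<le> blinfun_apply u x))"
  define Q where "Q = (\<lambda>(C :: ('a \<Rightarrow>\<^sub>L real) set, A :: 'a set, \<phi> :: 'a \<Rightarrow>\<^sub>L real) (C', A', \<phi>' :: 'a \<Rightarrow>\<^sub>L real). C \<subseteq> C' \<and> A \<subseteq> A' \<and> (\<forall>a\<in>A. blinfun_apply \<phi>' a = 0))"
  have "\<exists>s. \<forall>n. P (s n) \<and> Q (s n) (s (Suc n))"
  proof (rule dependent_nat_choice[where P = "\<lambda>_. P" and Q = "\<lambda>_. Q"])
    show "\<exists>s. P s"
    proof -
      obtain A where "finite A" "A \<subseteq> W" "\<forall>u\<in>convex hull {\<phi>0}. \<exists>x\<in>A. \<delta> \<le> blinfun_apply u x"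
        using net[of "{\<phi>0}"] \<open>\<phi>0 \<in> T\<close> by blast
      then have "P ({\<phi>0}, A, \<phi>0)" using \<open>\<phi>0 \<in> T\<close> by (simp only: P_def prod.case) blast
      then show ?thesis by blast
    qed
  next
    fix s and n :: nat assume "P s"
    then obtain C A \<phi> where s: "s = (C, A, \<phi>)" and C: "finite C" "C \<subseteq> T" and A: "finite A" "A \<subseteq> W"
      unfolding P_def by auto
    obtain \<phi>' where \<phi>': "\<phi>' \<in> T" "\<forall>a\<in>A. blinfun_apply \<phi>' a = 0" using Helly[OF A(1)] by blast
    obtain A' where A': "finite A'" "A' \<subseteq> W" "\<forall>u\<in>convex hull (insert \<phi>' C). \<exists>x\<in>A'. \<delta> \<le> blinfun_apply u x"
      using net[of "insert \<phi>' C"] C \<phi>'(1) by auto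
    have "P (insert \<phi>' C, A \<union> A', \<phi>')"
      unfolding P_def prod.case
    proof (intro conjI ballI)
      fix u assume "u \<in> convex hull (insert \<phi>' C)"
      then show "\<exists>x\<in>A \<union> A'. \<delta> \<le> blinfun_apply u x" using A'(3) by blast
    qed (use C A \<phi>' A' in blast)+
    moreover have "Q s (insert \<phi>' C, A \<union> A', \<phi>')"
      unfolding Q_def s prod.case using \<phi>'(2) by blast
    ultimately show "\<exists>s'. P s' \<and> Q s s'" by blast
  qed
  then obtain s where s: "\<And>n. P (s n)" "\<And>n. Q (s n) (s (Suc n))" by blast
  define C A f where "C n = fst (s n)" and "A n = fst (snd (s n))" and "f n = snd (snd (s n))" for n
  have s_eq: "s n = (C n, A n, f n)" for n by (simp add: C_def A_def f_def)
  have P: "C n \<subseteq> T" "f n \<in> C n" "A n \<subseteq> W" "\<And>u. u \<in> convex hull C n \<Longrightarrow> \<exists>x\<in>A n. \<delta> \<le> blinfun_apply u x" for n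
    using s(1)[of n] unfolding s_eq P_def by auto
  have Q: "C n \<subseteq> C (Suc n)" "A n \<subseteq> A (Suc n)" "\<And>a. a \<in> A n \<Longrightarrow> blinfun_apply (f (Suc n)) a = 0" for n
    using s(2)[of n] unfolding s_eq Q_def by auto
  have C_mono: "C m \<subseteq> C n" and A_mono: "A m \<subseteq> A n" if "m \<le> n" for m n
    using lift_Suc_mono_le[of C, OF Q(1) that] lift_Suc_mono_le[of A, OF Q(2) that] by auto
  have vanish: "blinfun_apply (f n) a = 0" if "m < n" "a \<in> A m" for m n a
  proof (cases n)
    case (Suc n')
    then have "a \<in> A n'" using that A_mono[of m n'] by auto
    then show ?thesis unfolding Suc by (rule Q(3))
  qed (use that(1) in simp)
  have "\<exists>x\<in>W. \<delta> \<le> blinfun_apply u x \<and> (\<forall>\<^sub>F n in sequentially. blinfun_apply (f n) x = 0)"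
    if u: "u \<in> convex hull (range f)" for u
  proof -
    obtain n where "u \<in> convex hull (f ` {..n})" using convex_hull_range_initial[OF u] ..
    moreover have "f ` {..n} \<subseteq> C n" using P(2) C_mono by auto
    ultimately have "u \<in> convex hull (C n)" using hull_mono by blast
    then obtain x where x: "x \<in> A n" "\<delta> \<le> blinfun_apply u x" using P(4) by blast
    moreover have "\<forall>\<^sub>F m in sequentially. blinfun_apply (f m) x = 0"
      using eventually_gt_at_top[of n] by eventually_elim (use vanish x(1) in auto)
    ultimately show ?thesis using P(3) by blast
  qed
  moreover have "norm (f n) \<le> 1" for n using P(1,2)[of n] by (auto simp: T_def)
  ultimately show ?thesis using \<delta> by blast
qed

text \<open>
  The convex hulls of the initial segments exhaust the hull, and each of them is compact, hence
  totally bounded.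
\<close>

lemma convex_hull_countable_dense:
  fixes f :: "nat \<Rightarrow> 'v::real_normed_vector"
  shows "\<exists>D :: nat \<Rightarrow> 'v. convex hull (range f) \<subseteq> closure (range D)"
proof -
  have "\<exists>k. finite k \<and> convex hull (f ` {..n}) \<subseteq> (\<Union>x\<in>k. ball x (inverse (real (Suc m))))" for n m
  proof -
    have cover: "convex hull (f ` {..n}) \<subseteq> (\<Union>x\<in>convex hull (f ` {..n}). ball x (inverse (real (Suc m))))"
      by auto
    have "compact (convex hull (f ` {..n}))" by (simp add: finite_imp_compact_convex_hull)
    then show ?thesis
    proof (rule compactE_image[OF _ _ cover])
      fix k assume "finite k" "convex hull (f ` {..n}) \<subseteq> (\<Union>x\<in>k. ball x (inverse (real (Suc m))))"
      then show ?thesis by (intro exI conjI)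
    qed (rule open_ball)
  qed
  then obtain k where k: "\<And>n m. finite (k n m)"
    "\<And>n m. convex hull (f ` {..n}) \<subseteq> (\<Union>x\<in>k n m. ball x (inverse (real (Suc m))))" by metis
  define S where "S = (\<Union>n. \<Union>m. k n m)"
  have "countable S" unfolding S_def using k(1) by (intro countable_UN) (auto intro: countable_finite)
  moreover have "S \<noteq> {}"
  proof -
    have "f 0 \<in> convex hull (f ` {..0})" by (auto intro: hull_inc)
    then show ?thesis using k(2)[of 0 0] unfolding S_def by fastforce
  qed
  moreover have "convex hull (range f) \<subseteq> closure S"
  proof
    fix u assume "u \<in> convex hull (range f)"
    then obtain n where n: "u \<in> convex hull (f ` {..n})" using convex_hull_range_initial by blast
    show "u \<in> closure S" unfolding closure_approachable
    proof (intro allI impI)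
      fix e :: real assume "0 < e"
      then obtain m where m: "inverse (real (Suc m)) < e" using reals_Archimedean by blast
      obtain y where "y \<in> k n m" "dist y u < inverse (real (Suc m))" using k(2)[of n m] n by auto
      then show "\<exists>y\<in>S. dist y u < e" using m unfolding S_def by force
    qed
  qed
  ultimately show ?thesis by (metis range_from_nat_into)
qed

text \<open>
  Countably many properties, each inherited by subsequences and insensitive to finite initial
  segments, are decided by one diagonal sequence: a property holds for it as soon as it holds for
  one of its subsequences.
\<close>

lemma diagonal_stabilisation:
  fixes E :: "nat \<Rightarrow> (nat \<Rightarrow> nat) \<Rightarrow> bool"
  assumes sub: "\<And>k r s. strict_mono s \<Longrightarrow> E k r \<Longrightarrow> E k (r \<circ> s)"
    and tail: "\<And>k r j. E k (r \<circ> (+) j) \<Longrightarrow> E k r"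
  shows "\<exists>r. strict_mono r \<and> (\<forall>k s. strict_mono s \<longrightarrow> E k (r \<circ> s) \<longrightarrow> E k r)"
proof -
  define P where "P k s \<longleftrightarrow> E k s \<or> (\<forall>r. strict_mono r \<longrightarrow> \<not> E k (s \<circ> r))" for k and s :: "nat \<Rightarrow> nat"
  interpret subseqs P
  proof
    fix n and s :: "nat \<Rightarrow> nat"
    show "\<exists>r'. strict_mono r' \<and> P n (s \<circ> r')"
    proof (cases "\<exists>r. strict_mono r \<and> E n (s \<circ> r)")
      case False
      then show ?thesis by (intro exI[of _ id]) (auto simp: P_def strict_mono_def)
    qed (auto simp: P_def)
  qed
  have P: "P k (diagseq \<circ> (+) (Suc k))" for k
  proof (rule diagseq_holds)
    fix r s :: "nat \<Rightarrow> nat" and n assume "strict_mono r" "P n s"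
    then show "P n (s \<circ> r)"
      using sub[of r n s] strict_mono_o[of r] unfolding P_def by (auto simp: comp_assoc)
  qed
  have "E k diagseq" if s: "strict_mono s" and E: "E k (diagseq \<circ> s)" for k s
  proof -
    define s' where "s' n = s (n + Suc k) - Suc k" for n
    have ge: "n \<le> s n" for n using s by (simp add: seq_suble)
    have s': "strict_mono s'" unfolding s'_def strict_mono_Suc_iff
    proof
      fix n
      have "s (n + Suc k) < s (Suc n + Suc k)" using s by (simp add: strict_mono_less)
      then show "s (n + Suc k) - Suc k < s (Suc n + Suc k) - Suc k"
        using ge[of "n + Suc k"] by linarith
    qed
    have "(diagseq \<circ> s) \<circ> (+) (Suc k) = (diagseq \<circ> (+) (Suc k)) \<circ> s'"
    proof
      fix n show "((diagseq \<circ> s) \<circ> (+) (Suc k)) n = ((diagseq \<circ> (+) (Suc k)) \<circ> s') n"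
        using ge[of "n + Suc k"] by (simp add: s'_def add.commute)
    qed
    moreover have "E k ((diagseq \<circ> s) \<circ> (+) (Suc k))"
      by (rule sub[OF _ E]) (simp add: strict_mono_def)
    ultimately have "E k (diagseq \<circ> (+) (Suc k))"
      using P[of k] s' unfolding P_def by auto
    then show ?thesis by (rule tail)
  qed
  then show ?thesis using subseq_diagseq by blast
qed

text \<open>
  Any linear functional below the upper limit of the \<open>g n\<close> is a cluster point; evaluating at
  \<open>- x\<close> turns the upper bound into the stated lower one. This replaces the weak-star compactness of the
  dual ball.
\<close>

lemma cluster_functional:
  fixes g :: "nat \<Rightarrow> 'a::real_normed_vector \<Rightarrow>\<^sub>L real"
  assumes g: "\<And>n. norm (g n) \<le> R"
  shows "\<exists>w :: 'a \<Rightarrow>\<^sub>L real. \<forall>x. \<forall>e>0. \<exists>\<^sub>F n in sequentially. blinfun_apply (g n) x < blinfun_apply w x + e"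
proof -
  let ?\<Phi> = "\<lambda>x. {t. \<forall>\<^sub>F n in sequentially. blinfun_apply (g n) x \<le> t}"
  have R: "0 \<le> R" using g[of 0] norm_ge_zero order_trans by blast
  have abs: "\<bar>blinfun_apply (g n) x\<bar> \<le> R * norm x" for n x
    using norm_blinfun[of "g n" x] mult_right_mono[OF g[of n], of "norm x"] by simp
  have bdd: "bdd_below (?\<Phi> x)" for x
  proof (rule bdd_belowI)
    fix t assume "t \<in> ?\<Phi> x"
    then obtain n where "blinfun_apply (g n) x \<le> t" by (auto simp: eventually_sequentially)
    then show "- (R * norm x) \<le> t" using abs[of n x] by (simp add: abs_le_iff)
  qed
  have mem: "R * norm x \<in> ?\<Phi> x" for x using abs[of _ x] by (auto simp: abs_le_iff)
  have "sublinear (\<lambda>x. Inf (?\<Phi> x))"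
  proof (rule sublinear_Inf)
    fix a b x y assume "a \<in> ?\<Phi> x" "b \<in> ?\<Phi> y"
    then have "\<forall>\<^sub>F n in sequentially. blinfun_apply (g n) x \<le> a \<and> blinfun_apply (g n) y \<le> b"
      by (auto intro: eventually_conj)
    then have "\<forall>\<^sub>F n in sequentially. blinfun_apply (g n) (x + y) \<le> a + b"
      by eventually_elim (simp add: blinfun.add_right)
    then show "\<exists>c\<in>?\<Phi> (x + y). c \<le> a + b" by blast
  next
    fix r a x assume "(0::real) < r" "a \<in> ?\<Phi> x"
    then have "r * a \<in> ?\<Phi> (r *\<^sub>R x)" by (simp add: blinfun.scaleR_right)
    then show "\<exists>c\<in>?\<Phi> (r *\<^sub>R x). c \<le> r * a" by blast
  next
    show "?\<Phi> x \<noteq> {}" for x using mem by blast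
  qed (rule bdd)
  moreover have "Inf (?\<Phi> x) \<le> R * norm x" for x using mem bdd by (rule cInf_lower)
  ultimately obtain w :: "'a \<Rightarrow>\<^sub>L real" where w: "\<And>x. blinfun_apply w x \<le> Inf (?\<Phi> x)"
    using Hahn_Banach_blinfun[OF _ _ R] by blast
  have "\<exists>\<^sub>F n in sequentially. blinfun_apply (g n) x < blinfun_apply w x + e" if "0 < e" for x e
  proof (rule ccontr)
    assume "\<not> ?thesis"
    then have "- (blinfun_apply w x + e) \<in> ?\<Phi> (- x)"
      by (auto simp: frequently_def not_less blinfun.minus_right elim: eventually_mono)
    then have "Inf (?\<Phi> (- x)) \<le> - (blinfun_apply w x + e)" using bdd by (rule cInf_lower)
    then show False using w[of "- x"] that by (simp add: blinfun.minus_right)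
  qed
  then show ?thesis by blast
qed

text \<open>
  James's theorem for a bounded norming set \<open>W\<close> in place of the unit ball. The sequence from
  \<open>James_sequence\<close> has a subsequence \<open>f\<close> for which the supremum of \<open>u - w\<close> over \<open>W\<close> is the same for all
  cluster points \<open>w\<close> (Pryce): if \<open>u - w\<close> exceeds \<open>t\<close> at \<open>x\<close>, then \<open>u - f n\<close> exceeds \<open>t\<close> at \<open>x\<close> along some
  subsequence, hence, after the diagonal choice, along the whole of \<open>f\<close> at some point of \<open>W\<close>, and so
  \<open>u - w'\<close> is at least \<open>t\<close> there. The gap is inherited by the cluster points because they are
  at most \<open>0\<close> at every point where the \<open>f n\<close> eventually vanish.
\<close>

theorem James:
  fixes W :: "'a::banach set" and F :: "('a \<Rightarrow>\<^sub>L real) \<Rightarrow>\<^sub>L real"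
  assumes bounded: "\<And>x. x \<in> W \<Longrightarrow> norm x \<le> R"
    and c: "0 < c" "\<And>\<phi>. \<exists>x\<in>W. c * norm \<phi> \<le> blinfun_apply \<phi> x"
    and attain: "\<And>\<phi> :: 'a \<Rightarrow>\<^sub>L real. \<exists>x\<in>W. \<forall>y\<in>W. blinfun_apply \<phi> y \<le> blinfun_apply \<phi> x"
  shows "\<exists>x. \<forall>\<phi>. blinfun_apply F \<phi> = blinfun_apply \<phi> x"
proof (rule ccontr)
  assume "\<not> ?thesis"
  then obtain \<theta> where \<theta>: "0 < \<theta>" "\<And>x. \<exists>\<phi>. norm \<phi> \<le> 1 \<and> \<theta> < blinfun_apply F \<phi> - blinfun_apply \<phi> x"
    using bidual_gap[of F] by blast
  obtain f0 :: "nat \<Rightarrow> 'a \<Rightarrow>\<^sub>L real" and \<delta> where \<delta>: "0 < \<delta>" and f0: "\<And>n. norm (f0 n) \<le> 1"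
    and f0_gap: "\<And>u. u \<in> convex hull (range f0) \<Longrightarrow>
      \<exists>x\<in>W. \<delta> \<le> blinfun_apply u x \<and> (\<forall>\<^sub>F n in sequentially. blinfun_apply (f0 n) x = 0)"
    using James_sequence[OF c \<theta>] by blast
  obtain D :: "nat \<Rightarrow> 'a \<Rightarrow>\<^sub>L real" where D: "convex hull (range f0) \<subseteq> closure (range D)"
    using convex_hull_countable_dense by blast
  \<comment> \<open>Pryce's stabilisation: whether some point of \<open>W\<close> keeps \<open>v\<close> above the sequence by \<open>t\<close>, for all
    \<open>v\<close> in a countable dense set and all rational \<open>t\<close>.\<close>
  define E' where "E' v t r \<longleftrightarrow> (\<exists>x\<in>W. \<forall>\<^sub>F n in sequentially. t < blinfun_apply v x - blinfun_apply (f0 (r n)) x)"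
    for v and t :: real and r :: "nat \<Rightarrow> nat"
  define E where "E k = (case from_nat k of (i, t) \<Rightarrow> E' (D i) (real_of_rat t))" for k :: nat
  obtain r where r: "strict_mono r" and r_stable: "\<And>k s. strict_mono s \<Longrightarrow> E k (r \<circ> s) \<Longrightarrow> E k r"
  proof -
    have sub: "E' v t (r \<circ> s)" if s: "strict_mono s" and E: "E' v t r" for v t r s
    proof -
      obtain x where x: "x \<in> W" "\<forall>\<^sub>F n in sequentially. t < blinfun_apply v x - blinfun_apply (f0 (r n)) x"
        using E unfolding E'_def by blast
      from eventually_subseq[OF s x(2)] x(1) show ?thesis unfolding E'_def by auto
    qed
    have tail: "E' v t r" if E: "E' v t (r \<circ> (+) j)" for v t r j
    proof -
      obtain x where x: "x \<in> W" "\<forall>\<^sub>F n in sequentially. t < blinfun_apply v x - blinfun_apply (f0 (r (n + j))) x"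
        using E unfolding E'_def by (auto simp: add.commute)
      from x(2) have "\<forall>\<^sub>F n in sequentially. t < blinfun_apply v x - blinfun_apply (f0 (r n)) x"
        by (subst (asm) eventually_sequentially_seg)
      with x(1) show ?thesis unfolding E'_def by blast
    qed
    have "\<exists>r. strict_mono r \<and> (\<forall>k s. strict_mono s \<longrightarrow> E k (r \<circ> s) \<longrightarrow> E k r)"
    proof (rule diagonal_stabilisation)
      fix k r and s :: "nat \<Rightarrow> nat" assume "strict_mono s" "E k r"
      then show "E k (r \<circ> s)" using sub by (auto simp: E_def split: prod.splits)
    next
      fix k r j assume "E k (r \<circ> (+) j)"
      then show "E k r"
        unfolding E_def by (cases "from_nat k :: nat \<times> rat") (simp only: prod.case, erule tail)
    qed
    then show ?thesis using that by blast
  qed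
  have stab: "E' (D i) (real_of_rat t) r" if "strict_mono s" "E' (D i) (real_of_rat t) (r \<circ> s)" for i t s
    using r_stable[OF that(1), of "to_nat (i, t)"] that(2) by (simp add: E_def)
  define f where "f = f0 \<circ> r"
  have f_hull: "convex hull (range f) \<subseteq> convex hull (range f0)"
    by (intro hull_mono) (auto simp: f_def)
  define \<Lambda> where "\<Lambda> = {w :: 'a \<Rightarrow>\<^sub>L real. \<forall>x. \<forall>e>0. \<exists>\<^sub>F n in sequentially. blinfun_apply (f n) x < blinfun_apply w x + e}"
  have \<Lambda>_lower: "\<exists>\<^sub>F n in sequentially. blinfun_apply w x - e < blinfun_apply (f n) x" if "w \<in> \<Lambda>" "0 < e" for w x e
  proof -
    have "\<exists>\<^sub>F n in sequentially. blinfun_apply (f n) (- x) < blinfun_apply w (- x) + e"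
      using that unfolding \<Lambda>_def by blast
    then show ?thesis by (rule frequently_elim1) (simp add: blinfun.minus_right)
  qed
  have W: "W \<noteq> {}" using attain by blast
  then have R: "0 \<le> R" using bounded norm_ge_zero order_trans by blast
  have abs: "\<bar>blinfun_apply v x\<bar> \<le> R * norm v" if "x \<in> W" for x and v :: "'a \<Rightarrow>\<^sub>L real"
    using norm_blinfun[of v x] mult_left_mono[OF bounded[OF that], of "norm v"] by (simp add: mult.commute)
  let ?\<sigma> = "\<lambda>v :: 'a \<Rightarrow>\<^sub>L real. SUP x\<in>W. blinfun_apply v x"
  have bdd: "bdd_above ((\<lambda>x. blinfun_apply v x) ` W)" for v :: "'a \<Rightarrow>\<^sub>L real"
    using abs by (intro bdd_aboveI2[where M="R * norm v"]) (simp add: abs_le_iff)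
  have stable_le: "?\<sigma> (u - w) \<le> ?\<sigma> (u - w')"
    if w: "w \<in> \<Lambda>" "w' \<in> \<Lambda>" and u: "u \<in> convex hull (range f)" for w w' u
  proof (rule ccontr)
    assume "\<not> ?thesis"
    then obtain x where x: "x \<in> W" "?\<sigma> (u - w') < blinfun_apply (u - w) x"
      using less_cSUP_iff[OF W bdd] by (auto simp: not_le)
    define \<eta> where "\<eta> = (blinfun_apply (u - w) x - ?\<sigma> (u - w')) / 2"
    have \<eta>: "0 < \<eta>" using x by (simp add: \<eta>_def)
    have "0 < \<eta> / (R + 1)" using \<eta> R by simp
    moreover have "u \<in> closure (range D)" using u f_hull D by blast
    ultimately obtain i where i: "norm (D i - u) < \<eta> / (R + 1)"
      unfolding closure_approachable dist_norm by (metis rangeE)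
    have close: "\<bar>blinfun_apply (D i) y - blinfun_apply u y\<bar> < \<eta>" if "y \<in> W" for y
    proof -
      have "\<bar>blinfun_apply (D i - u) y\<bar> \<le> R * norm (D i - u)" using abs[OF that] .
      also have "\<dots> \<le> (R + 1) * norm (D i - u)" by (intro mult_right_mono) auto
      also have "\<dots> < \<eta>" using i R by (simp add: field_simps)
      finally show ?thesis by (simp add: blinfun.diff_left)
    qed
    have "?\<sigma> (u - w') + \<eta> < blinfun_apply (D i) x - blinfun_apply w x"
    proof -
      have "2 * \<eta> = blinfun_apply u x - blinfun_apply w x - ?\<sigma> (u - w')"
        unfolding \<eta>_def by (simp add: blinfun.diff_left)
      then show ?thesis using close[OF x(1)] unfolding abs_less_iff by linarith
    qed
    then obtain t where t: "?\<sigma> (u - w') + \<eta> < real_of_rat t" "real_of_rat t < blinfun_apply (D i) x - blinfun_apply w x"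
      using of_rat_dense by blast
    \<comment> \<open>A cluster point only controls \<open>f\<close> infinitely often; hence the detour through a subsequence.\<close>
    define e where "e = blinfun_apply (D i) x - blinfun_apply w x - real_of_rat t"
    have "\<exists>\<^sub>F n in sequentially. blinfun_apply (f n) x < blinfun_apply w x + e"
    proof -
      have "0 < e" using t(2) by (simp add: e_def)
      with w(1) show ?thesis unfolding \<Lambda>_def by blast
    qed
    then have "infinite {n. blinfun_apply (f n) x < blinfun_apply w x + e}"
      by (simp add: frequently_cofinite flip: cofinite_eq_sequentially)
    then obtain s :: "nat \<Rightarrow> nat" where s: "strict_mono s" "\<And>n. blinfun_apply (f (s n)) x < blinfun_apply w x + e"
      using infinite_enumerate by (metis mem_Collect_eq)
    have "E' (D i) (real_of_rat t) (r \<circ> s)"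
      unfolding E'_def
    proof (intro bexI[OF _ x(1)] always_eventually allI)
      fix n
      show "real_of_rat t < blinfun_apply (D i) x - blinfun_apply (f0 ((r \<circ> s) n)) x"
        using s(2)[of n] by (simp add: e_def f_def)
    qed
    then obtain y where y: "y \<in> W" "\<forall>\<^sub>F n in sequentially. real_of_rat t < blinfun_apply (D i) y - blinfun_apply (f n) y"
      using stab[OF s(1)] unfolding E'_def f_def by auto
    have "real_of_rat t \<le> blinfun_apply (D i) y - blinfun_apply w' y"
    proof (rule ccontr)
      assume "\<not> ?thesis"
      then have "\<exists>\<^sub>F n in sequentially. blinfun_apply w' y - (real_of_rat t - (blinfun_apply (D i) y - blinfun_apply w' y)) < blinfun_apply (f n) y"
        by (intro \<Lambda>_lower[OF w(2)]) simp
      from frequently_eventually_frequently[OF this y(2)]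
      have "\<exists>\<^sub>F n in sequentially. False" by (rule frequently_elim1) auto
      then show False by simp
    qed
    also have "\<dots> < blinfun_apply (u - w') y + \<eta>" using close[OF y(1)] by (simp add: blinfun.diff_left abs_less_iff)
    also have "\<dots> \<le> ?\<sigma> (u - w') + \<eta>" using cSUP_upper[OF y(1) bdd] by simp
    finally show False using t(1) by simp
  qed
  have w_hull: "w \<in> \<Lambda>"
    if g: "\<And>n. g n \<in> convex hull (f ` {n..})"
      and w: "\<And>x e. 0 < e \<Longrightarrow> \<exists>\<^sub>F n in sequentially. blinfun_apply (g n) x < blinfun_apply w x + e" for g w
  proof (rule ccontr)
    assume "w \<notin> \<Lambda>"
    then obtain x e where e: "0 < e" "\<forall>\<^sub>F n in sequentially. blinfun_apply w x + e \<le> blinfun_apply (f n) x"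
      unfolding \<Lambda>_def by (auto simp: frequently_def not_less)
    then obtain N where N: "\<And>n. N \<le> n \<Longrightarrow> blinfun_apply w x + e \<le> blinfun_apply (f n) x"
      by (auto simp: eventually_sequentially)
    have half: "convex {v :: 'a \<Rightarrow>\<^sub>L real. blinfun_apply w x + e \<le> blinfun_apply v x}"
    proof -
      have "linear (\<lambda>v :: 'a \<Rightarrow>\<^sub>L real. blinfun_apply v x)"
        by (rule linearI) (simp_all add: blinfun.add_left blinfun.scaleR_left)
      from convex_linear_vimage[OF this, of "{blinfun_apply w x + e..}"] show ?thesis
        by (simp add: vimage_def)
    qed
    have "blinfun_apply w x + e \<le> blinfun_apply (g n) x" if "N \<le> n" for n
    proof -
      have "convex hull (f ` {n..}) \<subseteq> {v. blinfun_apply w x + e \<le> blinfun_apply v x}"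
        using N that half by (intro hull_minimal) auto
      then show ?thesis using g[of n] by blast
    qed
    then have "\<forall>\<^sub>F n in sequentially. blinfun_apply w x + e \<le> blinfun_apply (g n) x"
      by (auto simp: eventually_sequentially)
    with w[OF e(1), of x] show False by (simp add: frequently_def not_less)
  qed
  show False
  proof (rule no_attained_limit[of W "\<lambda>x v. blinfun_apply v x" R f 1 \<Lambda> \<delta>])
    show "W \<noteq> {}" "0 < \<delta>" by fact+
    show "linear (\<lambda>v :: 'a \<Rightarrow>\<^sub>L real. blinfun_apply v x)" for x
      by (rule linearI) (simp_all add: blinfun.add_left blinfun.scaleR_left)
    show "\<bar>blinfun_apply v x\<bar> \<le> R * norm v" if "x \<in> W" for x and v :: "'a \<Rightarrow>\<^sub>L real" using abs[OF that] .
    show "norm (f n) \<le> 1" for n using f0 by (simp add: f_def)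
    show "\<exists>w\<in>\<Lambda>. \<forall>x\<in>W. \<forall>e>0. \<exists>\<^sub>F n in sequentially. blinfun_apply (g n) x < blinfun_apply w x + e"
      if g: "\<And>n. g n \<in> convex hull (f ` {n..})" for g
    proof -
      have "norm (g n) \<le> 1" for n
      proof -
        have "convex hull (f ` {n..}) \<subseteq> cball 0 1" using f0 by (intro hull_minimal) (auto simp: f_def)
        then show ?thesis using g[of n] by auto
      qed
      from cluster_functional[of g, OF this] w_hull[OF g] show ?thesis by blast
    qed
    show "?\<sigma> (u - w) = ?\<sigma> (u - w')" if "w \<in> \<Lambda>" "w' \<in> \<Lambda>" "u \<in> convex hull (range f)" for w w' u
      using stable_le[OF that] stable_le[OF that(2,1,3)] by (rule antisym)
    show "\<exists>x\<in>W. \<delta> \<le> blinfun_apply (u - w) x" if w: "w \<in> \<Lambda>" and u: "u \<in> convex hull (range f)" for w u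
    proof -
      obtain x where x: "x \<in> W" "\<delta> \<le> blinfun_apply u x" "\<forall>\<^sub>F n in sequentially. blinfun_apply (f0 n) x = 0"
        using f0_gap u f_hull by blast
      have f_x: "\<forall>\<^sub>F n in sequentially. blinfun_apply (f n) x = 0"
        using eventually_subseq[OF r] x(3) by (auto simp: f_def)
      have "blinfun_apply w x \<le> 0"
      proof (rule ccontr)
        assume "\<not> ?thesis"
        then have "\<exists>\<^sub>F n in sequentially. blinfun_apply w x - blinfun_apply w x < blinfun_apply (f n) x"
          by (intro \<Lambda>_lower[OF w]) simp
        from frequently_eventually_frequently[OF this f_x]
        have "\<exists>\<^sub>F n in sequentially. False" by (rule frequently_elim1) auto
        then show False by simp
      qed
      then show ?thesis using x by (intro bexI[of _ x]) (auto simp: blinfun.diff_left)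
    qed
    show "\<exists>x\<in>W. \<forall>y\<in>W. blinfun_apply (h - w) y \<le> blinfun_apply (h - w) x" for h w :: "'a \<Rightarrow>\<^sub>L real"
      by (rule attain)
  qed
qed

section \<open>Real parts of scalars and of functionals\<close>

definition scalar_embedding :: "'k::real_or_complex_field \<Rightarrow> complex" where
  "scalar_embedding = (SOME h :: 'k \<Rightarrow> complex.
       (\<forall>x y. h (x + y) = h x + h y) \<and>
       (\<forall>x y. h (x * y) = h x * h y) \<and>
       (\<forall>r x. h (r *\<^sub>R x) = r *\<^sub>R h x) \<and>
       h 1 = 1 \<and>
       (\<forall>x. norm (h x) = norm x) \<and>
       (range h = \<real> \<or> range h = UNIV))"

lemma scalar_embedding:
  fixes a b :: "'k::real_or_complex_field"
  shows scalar_embedding_add: "scalar_embedding (a + b) = scalar_embedding a + scalar_embedding b"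
    and scalar_embedding_mult: "scalar_embedding (a * b) = scalar_embedding a * scalar_embedding b"
    and scalar_embedding_scaleR: "scalar_embedding (r *\<^sub>R a) = r *\<^sub>R scalar_embedding a"
    and scalar_embedding_one: "scalar_embedding (1 :: 'k) = 1"
    and norm_scalar_embedding: "norm (scalar_embedding a) = norm a"
    and range_scalar_embedding:
      "range (scalar_embedding :: 'k \<Rightarrow> complex) = \<real> \<or> range (scalar_embedding :: 'k \<Rightarrow> complex) = UNIV"
  using someI_ex[OF real_or_complex[where 'a='k], folded scalar_embedding_def] by blast+

lemma scalar_embedding_of_real: "scalar_embedding (of_real r :: 'k::real_or_complex_field) = of_real r"
  by (simp add: of_real_def scalar_embedding_scaleR scalar_embedding_one)

lemma linear_scalar_embedding: "linear (scalar_embedding :: 'k::real_or_complex_field \<Rightarrow> complex)"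
  by (rule linearI) (simp_all add: scalar_embedding)

lemma scalar_embedding_eqD:
  fixes a b :: "'k::real_or_complex_field"
  assumes "scalar_embedding a = scalar_embedding b" shows "a = b"
proof -
  have "norm (a - b) = norm (scalar_embedding a - scalar_embedding b)"
    by (metis norm_scalar_embedding linear_diff linear_scalar_embedding)
  then show ?thesis using assms by simp
qed

text \<open>
  The real part with respect to the chosen embedding; for \<open>\<K> = \<real>\<close> it is the identity.
\<close>

definition re :: "'k::real_or_complex_field \<Rightarrow> real" where "re a = Re (scalar_embedding a)"

lemma re_add: "re (a + b) = re a + re b"
  and re_diff: "re (a - b) = re a - re b"
  and re_scaleR: "re (r *\<^sub>R a) = r * re a"
  and re_of_real: "re (of_real r) = r"
  by (simp_all add: re_def scalar_embedding scalar_embedding_of_real linear_diff[OF linear_scalar_embedding])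

lemma re_of_real_mult: "re (of_real r * a) = r * re a"
  using re_scaleR[of r a] by (simp add: scaleR_conv_of_real)

lemma abs_re_le_norm: "\<bar>re a\<bar> \<le> norm a"
  unfolding re_def using abs_Re_le_cmod[of "scalar_embedding a"] by (simp add: norm_scalar_embedding)

lemma re_le_norm: "re a \<le> norm a"
  using abs_re_le_norm[of a] by simp

lemma bounded_linear_re: "bounded_linear re"
  by (rule bounded_linear_intro[of _ 1]) (auto simp: re_add re_scaleR abs_re_le_norm)

lemma re_eq_norm_imp_of_real:
  fixes a :: "'k::real_or_complex_field"
  assumes "norm a \<le> re a" shows "a = of_real (re a)"
proof (rule scalar_embedding_eqD)
  let ?z = "scalar_embedding a"
  have "cmod ?z = Re ?z" using assms re_le_norm[of a] by (simp add: norm_scalar_embedding re_def)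
  then have "Im ?z = 0"
    by (metis abs_Re_le_cmod abs_of_nonneg add_cancel_right_right cmod_power2 norm_ge_zero power2_eq_iff_nonneg zero_eq_power2)
  then show "?z = scalar_embedding (of_real (re a) :: 'k)"
    by (simp add: scalar_embedding_of_real re_def complex_eq_iff)
qed

lemma unit_rotation:
  fixes a :: "'k::real_or_complex_field"
  shows "\<exists>\<theta>. norm \<theta> = 1 \<and> \<theta> * a = of_real (norm a)"
proof (cases "a = 0")
  case True
  then show ?thesis by (intro exI[of _ 1]) simp
next
  case False
  then show ?thesis by (intro exI[of _ "of_real (norm a) / a"]) (simp add: norm_divide)
qed

lemma scalars_cases:
  obtains (real) "\<And>a :: 'k::real_or_complex_field. a = of_real (re a)"
  | (complex) \<iota> :: "'k::real_or_complex_field" where "\<iota> * \<iota> = -1" "\<And>r. re (of_real r * \<iota>) = 0"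
      "\<And>a :: 'k::real_or_complex_field. \<exists>s t. a = of_real s + of_real t * \<iota>"
proof -
  consider "range (scalar_embedding :: 'k \<Rightarrow> complex) = \<real>" | "range (scalar_embedding :: 'k \<Rightarrow> complex) = UNIV"
    using range_scalar_embedding by blast
  then show thesis
  proof cases
    case 1
    show ?thesis
    proof (rule real, rule scalar_embedding_eqD)
      fix a :: 'k
      have "scalar_embedding a \<in> \<real>" using 1 by blast
      then show "scalar_embedding a = scalar_embedding (of_real (re a) :: 'k)"
        by (simp add: scalar_embedding_of_real re_def)
    qed
  next
    case 2
    then obtain \<iota> :: 'k where \<iota>: "scalar_embedding \<iota> = \<i>" by (metis UNIV_I imageE)
    show ?thesis
    proof (rule complex)
      show "\<iota> * \<iota> = -1"
      proof (rule scalar_embedding_eqD)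
        show "scalar_embedding (\<iota> * \<iota>) = scalar_embedding (-1 :: 'k)"
          using scalar_embedding_of_real[where 'k='k, of "-1"] by (simp add: scalar_embedding_mult \<iota>)
      qed
      show "re (of_real r * \<iota>) = 0" for r by (simp add: re_def scalar_embedding_mult scalar_embedding_of_real \<iota>)
      fix a :: 'k
      have "a = of_real (Re (scalar_embedding a)) + of_real (Im (scalar_embedding a)) * \<iota>"
        by (rule scalar_embedding_eqD)
          (simp add: scalar_embedding scalar_embedding_of_real \<iota> complex_eq_iff)
      then show "\<exists>s t. a = of_real s + of_real t * \<iota>" by blast
    qed
  qed
qed

context banach_over
begin

lemma dual_iff: "f \<in> dual smul \<longleftrightarrow> bounded_linear f \<and> (\<forall>c x. f (smul c x) = c * f x)"
proof
  assume "bounded_linear f \<and> (\<forall>c x. f (smul c x) = c * f x)"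
  then show "f \<in> dual smul"
    unfolding dual_def Vector_Spaces.linear_iff
    using vector_space_axioms bounded_linear.linear[THEN linear_add, of f]
    by (auto simp: vector_space_def algebra_simps)
qed (auto simp: dual_def Vector_Spaces.linear_iff)

lemma operators_iff: "T \<in> operators smul \<longleftrightarrow> bounded_linear T \<and> (\<forall>c x. T (smul c x) = smul c (T x))"
proof
  assume "bounded_linear T \<and> (\<forall>c x. T (smul c x) = smul c (T x))"
  then show "T \<in> operators smul"
    unfolding operators_def Vector_Spaces.linear_iff
    using vector_space_axioms bounded_linear.linear[THEN linear_add, of T] by auto
qed (auto simp: operators_def Vector_Spaces.linear_iff)

lemma dual_smul: "f \<in> dual smul \<Longrightarrow> f (smul c x) = c * f x"
  and dual_bounded_linear: "f \<in> dual smul \<Longrightarrow> bounded_linear f"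
  by (auto simp: dual_iff)

lemma dual_norm_le: "f \<in> dual smul \<Longrightarrow> norm (f x) \<le> onorm f * norm x"
  by (rule onorm[OF dual_bounded_linear])

lemma dual_rotate:
  assumes f: "f \<in> dual smul"
  shows "\<exists>y. norm y = norm x \<and> re (f y) = norm (f x)"
proof -
  obtain \<theta> where "norm \<theta> = 1" "\<theta> * f x = of_real (norm (f x))" using unit_rotation by blast
  then show ?thesis
    by (intro exI[of _ "smul \<theta> x"]) (simp add: norm_scale dual_smul[OF f] re_of_real)
qed

lemma dual_norm_le_of_re:
  assumes f: "f \<in> dual smul" and "\<And>x. re (f x) \<le> K * norm x"
  shows "norm (f x) \<le> K * norm x"
  using dual_rotate[OF f, of x] assms(2) by metis

lemma dual_eqI:
  assumes f: "f \<in> dual smul" and g: "g \<in> dual smul" and re: "\<And>x. re (f x) = re (g x)"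
  shows "f = g"
proof
  fix x
  obtain \<theta> where \<theta>: "norm \<theta> = 1" "\<theta> * (f x - g x) = of_real (norm (f x - g x))" using unit_rotation by blast
  have "re (\<theta> * (f x - g x)) = 0"
    using re[of "smul \<theta> x"] by (simp add: dual_smul[OF f] dual_smul[OF g] right_diff_distrib re_diff)
  then show "f x = g x" by (simp add: \<theta>(2) re_of_real)
qed

text \<open>
  The Bohnenblust--Sobczyk formula \<open>\<phi> x - \<iota> \<phi> (\<iota> x)\<close>; over \<open>\<real>\<close> there is nothing to complexify.
\<close>

lemma dual_extension:
  fixes \<phi> :: "'a \<Rightarrow>\<^sub>L real"
  shows "\<exists>f\<in>dual smul. \<forall>x. re (f x) = blinfun_apply \<phi> x"
proof (cases rule: scalars_cases[where 'k='k])
  case real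
  have "(\<lambda>x. of_real (blinfun_apply \<phi> x)) \<in> dual smul"
    unfolding dual_iff
  proof (intro conjI allI)
    show "bounded_linear (\<lambda>x. of_real (blinfun_apply \<phi> x) :: 'k)"
      by (intro bounded_linear_compose[OF bounded_linear_of_real] blinfun.bounded_linear_right)
    fix c :: 'k and x
    obtain r where "c = of_real r" using real by blast
    then show "of_real (blinfun_apply \<phi> (smul c x)) = c * of_real (blinfun_apply \<phi> x)"
      by (simp add: scale_of_real blinfun.scaleR_right)
  qed
  then show ?thesis by (intro bexI[of _ "\<lambda>x. of_real (blinfun_apply \<phi> x)"]) (simp_all add: re_of_real)
next
  case (complex \<iota>)
  let ?f = "\<lambda>x. of_real (blinfun_apply \<phi> x) - of_real (blinfun_apply \<phi> (smul \<iota> x)) * \<iota>"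
  have bl: "bounded_linear (smul \<iota>)"
    by (rule bounded_linear_intro[of _ "norm \<iota>"])
      (simp_all add: scale_right_distrib norm_scale mult.commute scale_left_commute flip: scale_of_real)
  have add: "?f (x + y) = ?f x + ?f y" for x y
    by (simp add: blinfun.add_right scale_right_distrib algebra_simps)
  have real: "?f (smul (of_real r) x) = of_real r * ?f x" for r x
  proof -
    have "smul \<iota> (r *\<^sub>R x) = r *\<^sub>R smul \<iota> x"
      using scale_left_commute[of \<iota> "of_real r" x] by (simp only: scale_of_real)
    then show ?thesis by (simp add: scale_of_real blinfun.scaleR_right algebra_simps)
  qed
  have imag: "?f (smul \<iota> x) = \<iota> * ?f x" for x
  proof -
    have "smul \<iota> (smul \<iota> x) = - x" using complex(1) by simp
    moreover have "\<iota> * (a * \<iota>) = - a" for a :: 'k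
      using complex(1) by (metis mult.left_commute mult.right_neutral mult_minus_right)
    ultimately show ?thesis
      unfolding right_diff_distrib by (simp only: blinfun.minus_right of_real_minus mult_minus_left mult.commute[of \<iota> "of_real _"] minus_minus diff_minus_eq_add add.commute)
  qed
  have "?f \<in> dual smul"
    unfolding dual_iff
  proof (intro conjI allI)
    show "bounded_linear ?f"
      by (intro bounded_linear_sub bounded_linear_compose[OF bounded_linear_mult_left]
          bounded_linear_compose[OF bounded_linear_of_real] blinfun.bounded_linear_right
          bounded_linear_compose[OF blinfun.bounded_linear_right bl])
    fix c :: 'k and x
    obtain s t where c: "c = of_real s + of_real t * \<iota>" using complex(3) by blast
    have "?f (smul c x) = ?f (smul (of_real s) x + smul (of_real t) (smul \<iota> x))"
      by (simp add: c scale_left_distrib)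
    also have "\<dots> = of_real s * ?f x + of_real t * (\<iota> * ?f x)"
      by (simp only: add real imag)
    also have "\<dots> = c * ?f x" by (simp add: c algebra_simps)
    finally show "?f (smul c x) = c * ?f x" .
  qed
  then show ?thesis
    by (intro bexI[of _ ?f]) (simp_all add: re_diff re_of_real complex(2))
qed

lemma support_functional:
  assumes "z \<noteq> 0"
  shows "\<exists>g\<in>dual smul. onorm g = 1 \<and> g z = of_real (norm z)"
proof -
  obtain \<phi> :: "'a \<Rightarrow>\<^sub>L real" where \<phi>: "norm \<phi> \<le> 1" "blinfun_apply \<phi> z = norm z"
    using norming_functional by blast
  obtain g where g: "g \<in> dual smul" "\<And>x. re (g x) = blinfun_apply \<phi> x"
    using dual_extension by blast
  have "blinfun_apply \<phi> x \<le> 1 * norm x" for x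
    using norm_blinfun[of \<phi> x] mult_right_mono[OF \<phi>(1), of "norm x"] by simp
  then have le: "norm (g x) \<le> 1 * norm x" for x
    using g by (intro dual_norm_le_of_re) auto
  have gz: "g z = of_real (norm z)"
    using re_eq_norm_imp_of_real[of "g z"] le[of z] g(2)[of z] \<phi>(2) by simp
  moreover have "onorm g = 1"
  proof (rule antisym)
    show "onorm g \<le> 1" using le by (intro onorm_bound) auto
    show "1 \<le> onorm g" using dual_norm_le[OF g(1), of z] assms by (simp add: gz)
  qed
  ultimately show ?thesis using g(1) by blast
qed

text \<open>
  An element \<open>\<Phi>\<close> of the bidual over \<open>\<K>\<close> induces the real functional \<open>\<phi> \<mapsto> re (\<Phi> f)\<close>, where \<open>f\<close> is the
  functional with real part \<open>\<phi>\<close>. A representing point for it represents the real part of \<open>\<Phi>\<close>, and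
  rotating \<open>f\<close> by scalars of modulus one recovers \<open>\<Phi>\<close>.
\<close>

lemma reflexive_space_of_real:
  assumes refl: "\<And>F :: ('a \<Rightarrow>\<^sub>L real) \<Rightarrow>\<^sub>L real. \<exists>x. \<forall>\<phi>. blinfun_apply F \<phi> = blinfun_apply \<phi> x"
  shows "reflexive_space smul"
  unfolding reflexive_space_def
proof (intro equalityI subsetI)
  fix \<Phi> assume "\<Phi> \<in> range (canonical_embedding smul)"
  then obtain x where \<Phi>: "\<Phi> = (\<lambda>f\<in>dual smul. f x)" by (auto simp: canonical_embedding_def)
  have "norm (f x) \<le> norm x * onorm f" if "f \<in> dual smul" for f
    using dual_norm_le[OF that, of x] by (simp add: mult.commute)
  moreover have "(\<lambda>y. f y + g y) \<in> dual smul" if "f \<in> dual smul" "g \<in> dual smul" for f g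
    using that by (auto simp: dual_iff bounded_linear_add algebra_simps)
  moreover have "(\<lambda>y. c * f y) \<in> dual smul" if "f \<in> dual smul" for f c
    using that by (auto simp: dual_iff bounded_linear_const_mult)
  ultimately show "\<Phi> \<in> bidual smul"
    unfolding bidual_def \<Phi> by auto
next
  fix \<Phi> assume "\<Phi> \<in> bidual smul"
  then obtain B where ext: "\<Phi> \<in> extensional (dual smul)"
    and add: "\<And>f g. f \<in> dual smul \<Longrightarrow> g \<in> dual smul \<Longrightarrow> \<Phi> (\<lambda>x. f x + g x) = \<Phi> f + \<Phi> g"
    and scale: "\<And>c f. f \<in> dual smul \<Longrightarrow> \<Phi> (\<lambda>x. c * f x) = c * \<Phi> f"
    and B: "\<And>f. f \<in> dual smul \<Longrightarrow> norm (\<Phi> f) \<le> B * onorm f"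
    unfolding bidual_def by blast
  obtain K where K: "\<And>\<phi>. K \<phi> \<in> dual smul" "\<And>\<phi> x. re (K \<phi> x) = blinfun_apply \<phi> x"
    using dual_extension by metis
  have K_eq: "K \<phi> = f" if "f \<in> dual smul" "\<And>x. re (f x) = blinfun_apply \<phi> x" for \<phi> f
    using that K by (intro dual_eqI) auto
  have K_add: "K (\<phi> + \<psi>) = (\<lambda>x. K \<phi> x + K \<psi> x)" for \<phi> \<psi>
    using K(1)[of \<phi>] K(1)[of \<psi>]
    by (intro K_eq) (auto simp: dual_iff bounded_linear_add algebra_simps re_add K(2) blinfun.add_left)
  have K_scale: "K (r *\<^sub>R \<phi>) = (\<lambda>x. of_real r * K \<phi> x)" for r \<phi>
    using K(1)[of \<phi>]
    by (intro K_eq) (auto simp: dual_iff bounded_linear_const_mult re_of_real_mult K(2) blinfun.scaleR_left)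
  have K_norm: "onorm (K \<phi>) \<le> norm \<phi>" for \<phi>
  proof (rule onorm_bound)
    have "blinfun_apply \<phi> x \<le> norm \<phi> * norm x" for x using norm_blinfun[of \<phi> x] by simp
    then show "norm (K \<phi> x) \<le> norm \<phi> * norm x" for x
      using K by (intro dual_norm_le_of_re) auto
  qed simp
  have "bounded_linear (\<lambda>\<phi>. re (\<Phi> (K \<phi>)))"
  proof (rule bounded_linear_intro[of _ "\<bar>B\<bar>"])
    fix \<phi> \<psi> r
    show "re (\<Phi> (K (\<phi> + \<psi>))) = re (\<Phi> (K \<phi>)) + re (\<Phi> (K \<psi>))"
      using add K(1) by (simp add: K_add re_add)
    show "re (\<Phi> (K (r *\<^sub>R \<phi>))) = r *\<^sub>R re (\<Phi> (K \<phi>))"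
      using scale K(1) by (simp add: K_scale re_of_real_mult)
    have "B * onorm (K \<phi>) \<le> \<bar>B\<bar> * norm \<phi>"
      using K_norm[of \<phi>] onorm_pos_le[OF dual_bounded_linear[OF K(1)], of \<phi>] by (intro mult_mono) auto
    then show "norm (re (\<Phi> (K \<phi>))) \<le> norm \<phi> * \<bar>B\<bar>"
      using abs_re_le_norm[of "\<Phi> (K \<phi>)"] B[OF K(1), of \<phi>] by (simp add: mult.commute)
  qed
  then have "\<exists>F :: ('a \<Rightarrow>\<^sub>L real) \<Rightarrow>\<^sub>L real. \<forall>\<phi>. blinfun_apply F \<phi> = re (\<Phi> (K \<phi>))"
    by (metis bounded_linear_Blinfun_apply)
  then obtain x where x: "\<And>\<phi>. re (\<Phi> (K \<phi>)) = blinfun_apply \<phi> x"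
    using refl by metis
  have re_eq: "re (\<Phi> f) = re (f x)" if f: "f \<in> dual smul" for f
  proof -
    have bl: "bounded_linear (\<lambda>x. re (f x))"
      using bounded_linear_compose[OF bounded_linear_re dual_bounded_linear[OF f]] .
    have "K (Blinfun (\<lambda>x. re (f x))) = f"
      using f by (intro K_eq) (simp_all add: bounded_linear_Blinfun_apply[OF bl])
    then show ?thesis using x[of "Blinfun (\<lambda>x. re (f x))"] by (simp add: bounded_linear_Blinfun_apply[OF bl])
  qed
  have "\<Phi> f = f x" if f: "f \<in> dual smul" for f
  proof -
    obtain \<theta> where \<theta>: "\<theta> * (\<Phi> f - f x) = of_real (norm (\<Phi> f - f x))" using unit_rotation by blast
    have "(\<lambda>y. \<theta> * f y) \<in> dual smul"
      using f by (auto simp: dual_iff bounded_linear_const_mult)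
    then have "re (\<theta> * (\<Phi> f - f x)) = 0"
      using re_eq[of "\<lambda>y. \<theta> * f y"] scale[OF f, of \<theta>] by (simp add: right_diff_distrib re_diff)
    then show ?thesis by (simp add: \<theta> re_of_real)
  qed
  then have "\<Phi> = canonical_embedding smul x"
    using ext unfolding canonical_embedding_def by (intro extensionalityI[of _ "dual smul"]) auto
  then show "\<Phi> \<in> range (canonical_embedding smul)" by blast
qed

section \<open>Rank-one operators and reflexivity\<close>

lemma state_value_le_numerical_radius:
  assumes T: "T \<in> operators smul" and s: "(y, g) \<in> states smul"
  shows "norm (g (T y)) \<le> numerical_radius smul T"
proof -
  have bd: "norm (g (T y)) \<le> onorm T" if "(y, g) \<in> states smul" for y g
  proof -
    have "norm (g (T y)) \<le> onorm g * norm (T y)" using that by (intro dual_norm_le) (auto simp: states_def)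
    also have "\<dots> \<le> onorm T * norm y"
      using that T onorm[of T y] by (auto simp: states_def operators_def)
    finally show ?thesis using that by (simp add: states_def)
  qed
  have "bdd_above ((\<lambda>(y, g). norm (g (T y))) ` states smul)"
    using bd by (intro bdd_aboveI2[of _ _ "onorm T"]) auto
  from cSUP_upper[OF s this] show ?thesis by (simp add: numerical_radius_def)
qed

text \<open>
  Take a unit vector \<open>y\<close> at which \<open>\<phi>\<close> is at least half its norm, and move it far in the direction
  of \<open>x0\<close>, rotated so that the real part of \<open>f\<close> does not decrease. A functional that supports the resulting vector \<open>z\<close>
  is large at \<open>x0\<close>, since the norm has grown considerably on the way from \<open>y\<close> to \<open>z\<close>.
\<close>

lemma rank_one_norming:
  fixes \<phi> :: "'a \<Rightarrow>\<^sub>L real"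
  assumes x0: "norm x0 = 1" and f: "f \<in> dual smul" "\<And>x. re (f x) = blinfun_apply \<phi> x"
  shows "\<exists>(y, g)\<in>states smul. norm \<phi> / 20 \<le> norm (g x0 * f y)"
proof -
  have "\<exists>y. norm y = 1 \<and> norm \<phi> / 2 \<le> blinfun_apply \<phi> y"
  proof (rule ccontr)
    assume "\<not> ?thesis"
    then have lt: "blinfun_apply \<phi> y < norm \<phi> / 2" if "norm y = 1" for y using that by (meson not_le)
    have unit: "\<bar>blinfun_apply \<phi> y\<bar> \<le> norm \<phi> / 2" if "norm y = 1" for y
      using lt[OF that] lt[of "- y"] that by (simp add: blinfun.minus_right)
    have "norm \<phi> \<le> norm \<phi> / 2"
    proof (rule norm_blinfun_bound)
      fix y show "norm (blinfun_apply \<phi> y) \<le> norm \<phi> / 2 * norm y"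
        using unit[of "(1 / norm y) *\<^sub>R y"] by (cases "y = 0") (simp_all add: blinfun.scaleR_right field_simps)
    qed simp
    then show False using lt[OF x0] unit[OF x0] by simp
  qed
  then obtain y where y: "norm y = 1" "norm \<phi> / 2 \<le> blinfun_apply \<phi> y" by blast
  obtain \<theta> where \<theta>: "norm \<theta> = 1" "\<theta> * f x0 = of_real (norm (f x0))" using unit_rotation by blast
  define v where "v = smul \<theta> x0"
  have v: "norm v = 1" by (simp add: v_def norm_scale \<theta> x0)
  \<comment> \<open>The factor 4 makes the norm of \<open>z\<close> at least 3, while \<open>g y\<close> has modulus at most 1.\<close>
  define z where "z = y + 4 *\<^sub>R v"
  have z: "3 \<le> norm z" "norm z \<le> 5"
    using norm_triangle_ineq2[of "4 *\<^sub>R v" "- y"] norm_triangle_ineq[of y "4 *\<^sub>R v"] v y(1) by (simp_all add: z_def add.commute)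
  have "blinfun_apply \<phi> z = blinfun_apply \<phi> y + 4 * norm (f x0)"
    using f(2)[of v] by (simp add: z_def blinfun.add_right blinfun.scaleR_right v_def dual_smul[OF f(1)] \<theta> re_of_real)
  then have fz: "norm \<phi> / 2 \<le> norm (f z)"
    using y(2) f(2)[of z] re_le_norm[of "f z"] norm_ge_zero[of "f x0"] by linarith
  obtain g where g: "g \<in> dual smul" "onorm g = 1" "g z = of_real (norm z)"
    using support_functional[of z] z by force
  interpret g: bounded_linear g using dual_bounded_linear[OF g(1)] .
  interpret f: bounded_linear f using dual_bounded_linear[OF f(1)] .
  have gx0: "1 / 2 \<le> norm (g x0)"
  proof -
    have "norm (g z) \<le> norm (g y) + norm (4 *\<^sub>R g v)"
      unfolding z_def g.add g.scaleR by (rule norm_triangle_ineq)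
    moreover have "norm (g y) \<le> 1" using dual_norm_le[OF g(1), of y] y(1) g(2) by simp
    moreover have "norm (g v) = norm (g x0)" by (simp add: v_def dual_smul[OF g(1)] norm_mult \<theta>)
    ultimately show ?thesis using z(1) by (simp add: g(3))
  qed
  let ?y = "(1 / norm z) *\<^sub>R z"
  have "z \<noteq> 0" using z(1) by auto
  then have "(?y, g) \<in> states smul"
    using g z by (simp add: states_def g.scaleR scaleR_conv_of_real)
  moreover have "norm \<phi> / 20 \<le> norm (g x0 * f ?y)"
  proof -
    have "norm \<phi> / 2 / 5 \<le> norm (f z) / norm z"
      using fz z by (intro frac_le) auto
    then have "(1 / 2) * (norm \<phi> / 2 / 5) \<le> norm (g x0) * (norm (f z) / norm z)"
      using gx0 by (intro mult_mono) auto
    then show ?thesis by (simp add: f.scaleR norm_mult)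
  qed
  ultimately show ?thesis by blast
qed

text \<open>
  The value of the rank-one operator \<open>y \<mapsto> f y \<cdot> x0\<close> at a state \<open>(y, g)\<close> is \<open>g x0 * f y\<close>. So the
  vectors \<open>g x0 \<cdot> y\<close>, closed up under rotations, form the set to which James's theorem is applied.
\<close>

theorem NRA_imp_real_reflexive:
  fixes F :: "('a \<Rightarrow>\<^sub>L real) \<Rightarrow>\<^sub>L real"
  assumes NRA: "operators smul = NRA smul"
  shows "\<exists>x. \<forall>\<phi>. blinfun_apply F \<phi> = blinfun_apply \<phi> x"
proof -
  \<comment> \<open>The zero operator attains its numerical radius, so there is a state and the space is not zero.\<close>
  have "(\<lambda>x. 0) \<in> NRA smul" unfolding NRA[symmetric] by (auto simp: operators_iff)
  then obtain x0 :: 'a where x0: "norm x0 = 1" by (auto simp: NRA_def states_def)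
  define W where "W = {smul \<theta> (smul (g x0) y) | \<theta> y g. norm \<theta> = 1 \<and> (y, g) \<in> states smul}"
  have W_val: "blinfun_apply \<phi> (smul \<theta> (smul (g x0) y)) = re (\<theta> * (g x0 * f y))"
    if "f \<in> dual smul" "\<And>x. re (f x) = blinfun_apply \<phi> x" for f \<phi> \<theta> y and g :: "'a \<Rightarrow> 'k"
    unfolding that(2)[symmetric] by (simp add: dual_smul[OF that(1)] mult.assoc del: scale_scale)
  have W_max: "\<exists>w\<in>W. blinfun_apply \<phi> w = norm (g x0 * f y)"
    if s: "(y, g) \<in> states smul" and f: "f \<in> dual smul" "\<And>x. re (f x) = blinfun_apply \<phi> x" for f \<phi> y g
  proof -
    obtain \<theta> where \<theta>: "norm \<theta> = 1" "\<theta> * (g x0 * f y) = of_real (norm (g x0 * f y))" using unit_rotation by blast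
    then have "smul \<theta> (smul (g x0) y) \<in> W" using s unfolding W_def by blast
    moreover have "blinfun_apply \<phi> (smul \<theta> (smul (g x0) y)) = norm (g x0 * f y)"
      unfolding W_val[OF f] \<theta>(2) by (rule re_of_real)
    ultimately show ?thesis by blast
  qed
  show ?thesis
  proof (rule James[of W 1 "1 / 20"])
    fix w assume "w \<in> W"
    then obtain \<theta> y g where w: "w = smul \<theta> (smul (g x0) y)" "norm \<theta> = 1" "(y, g) \<in> states smul"
      unfolding W_def by blast
    then show "norm w \<le> 1"
      using dual_norm_le[of g x0] x0 by (auto simp: norm_scale states_def norm_mult)
  next
    fix \<phi> :: "'a \<Rightarrow>\<^sub>L real"
    obtain f where f: "f \<in> dual smul" "\<And>x. re (f x) = blinfun_apply \<phi> x" using dual_extension by blast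
    obtain y g where yg: "(y, g) \<in> states smul" "norm \<phi> / 20 \<le> norm (g x0 * f y)"
      using rank_one_norming[OF x0 f] by blast
    then show "\<exists>w\<in>W. 1 / 20 * norm \<phi> \<le> blinfun_apply \<phi> w"
      using W_max[OF yg(1) f] by force
    let ?T = "\<lambda>y. smul (f y) x0"
    have T: "?T \<in> operators smul"
      unfolding operators_iff
    proof (intro conjI allI)
      interpret f: bounded_linear f using dual_bounded_linear[OF f(1)] .
      show "bounded_linear ?T"
      proof (rule bounded_linear_intro[of _ "onorm f"])
        show "norm (?T y) \<le> norm y * onorm f" for y
          using dual_norm_le[OF f(1), of y] by (simp add: norm_scale x0 mult.commute)
      qed (simp_all add: f.add f.scaleR scale_left_distrib scaleR_conv_of_real dual_smul[OF f(1)] flip: scale_of_real)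
    qed (simp add: dual_smul[OF f(1)])
    have val: "g (?T y) = g x0 * f y" if "(y, g) \<in> states smul" for y g
      using that by (simp add: states_def dual_smul mult.commute)
    have "?T \<in> NRA smul" using T NRA by simp
    then obtain y g where yg: "(y, g) \<in> states smul" and "numerical_radius smul ?T = norm (g (?T y))"
      by (auto simp: NRA_def)
    then have attained: "numerical_radius smul ?T = norm (g x0 * f y)" by (simp only: val)
    obtain w where w: "w \<in> W" "blinfun_apply \<phi> w = norm (g x0 * f y)"
      using W_max[OF yg f] by blast
    have "blinfun_apply \<phi> u \<le> blinfun_apply \<phi> w" if u_W: "u \<in> W" for u
    proof -
      obtain \<theta> y' g' where u: "u = smul \<theta> (smul (g' x0) y')" "norm \<theta> = 1" "(y', g') \<in> states smul"
        using u_W unfolding W_def by blast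
      have "blinfun_apply \<phi> u \<le> norm (\<theta> * (g' x0 * f y'))"
        unfolding u(1) W_val[OF f] by (rule re_le_norm)
      also have "\<dots> = norm (g' (?T y'))" unfolding val[OF u(3)] norm_mult u(2) by simp
      also have "\<dots> \<le> numerical_radius smul ?T" using T u(3) by (rule state_value_le_numerical_radius)
      finally show ?thesis unfolding w(2) attained .
    qed
    with w(1) show "\<exists>w\<in>W. \<forall>u\<in>W. blinfun_apply \<phi> u \<le> blinfun_apply \<phi> w" by blast
  qed simp
qed

end

section \<open>Projections in nonseparable reflexive spaces\<close>

text \<open>
  Allows a countable set of scalars to be used in generating a subspace. The action \<open>s\<close> is left general
  because it is needed both for the space and for its dual.
\<close>

lemma closure_closed_under_scaling:
  fixes s :: "'k::real_normed_vector \<Rightarrow> 'b::real_normed_vector \<Rightarrow> 'b"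
  assumes s: "bounded_bilinear s" and Q: "closure Q = UNIV"
    and add: "\<forall>x\<in>A. \<forall>y\<in>A. x + y \<in> A" and scale: "\<forall>q\<in>Q. \<forall>x\<in>A. s q x \<in> A"
  shows "x \<in> closure A \<Longrightarrow> y \<in> closure A \<Longrightarrow> x + y \<in> closure A"
    and "x \<in> closure A \<Longrightarrow> s c x \<in> closure A"
proof -
  assume "x \<in> closure A"
  then obtain X where X: "\<And>n. X n \<in> A" "X \<longlonglongrightarrow> x" unfolding closure_sequential by blast
  {
    assume "y \<in> closure A"
    then obtain Y where Y: "\<And>n. Y n \<in> A" "Y \<longlonglongrightarrow> y" unfolding closure_sequential by blast
    show "x + y \<in> closure A"
      unfolding closure_sequential using add X Y by (intro exI[of _ "\<lambda>n. X n + Y n"]) (auto intro: tendsto_add)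
  }
  have "c \<in> closure Q" using Q by simp
  then obtain C where C: "\<And>n. C n \<in> Q" "C \<longlonglongrightarrow> c" unfolding closure_sequential by blast
  show "s c x \<in> closure A"
    unfolding closure_sequential using scale X C
    by (intro exI[of _ "\<lambda>n. s (C n) (X n)"]) (auto intro: bounded_bilinear.tendsto[OF s])
qed

lemma scalars_countable_dense: "\<exists>Q :: 'k::real_or_complex_field set. countable Q \<and> closure Q = UNIV"
proof -
  obtain T where T: "countable T" "T \<subseteq> range (scalar_embedding :: 'k \<Rightarrow> complex)"
    "range (scalar_embedding :: 'k \<Rightarrow> complex) \<subseteq> closure T"
    using separable by blast
  obtain Q :: "'k set" where Q: "countable Q" "T = scalar_embedding ` Q"
    using T(1,2) by (meson countable_subset_image)
  have "c \<in> closure Q" for c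
    unfolding closure_approachable
  proof (intro allI impI)
    fix e :: real assume "0 < e"
    moreover have "scalar_embedding c \<in> closure T" using T(3) by blast
    ultimately obtain q where "q \<in> Q" "dist (scalar_embedding q) (scalar_embedding c) < e"
      unfolding closure_approachable Q(2) by blast
    then show "\<exists>q\<in>Q. dist q c < e"
      by (metis dist_norm linear_diff linear_scalar_embedding norm_scalar_embedding)
  qed
  with Q(1) show ?thesis by blast
qed

context banach_over
begin

lemma bounded_bilinear_smul: "bounded_bilinear smul"
proof
  fix r c x
  show "smul (r *\<^sub>R c) x = r *\<^sub>R smul c x"
    unfolding scaleR_conv_of_real scale_scale[symmetric] by (rule scale_of_real)
  show "smul c (r *\<^sub>R x) = r *\<^sub>R smul c x"
    using scale_left_commute[of c "of_real r" x] by (simp only: scale_of_real)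
  show "\<exists>K. \<forall>a b. norm (smul a b) \<le> norm a * norm b * K"
    by (intro exI[of _ 1]) (simp add: norm_scale)
qed (simp_all add: scale_left_distrib scale_right_distrib)

definition smul_blinfun :: "'k \<Rightarrow> 'a \<Rightarrow>\<^sub>L 'a" where "smul_blinfun c = Blinfun (smul c)"

lemma smul_blinfun_apply: "blinfun_apply (smul_blinfun c) x = smul c x"
  unfolding smul_blinfun_def
  by (simp add: bounded_linear_Blinfun_apply bounded_bilinear.bounded_linear_right[OF bounded_bilinear_smul])

lemma bounded_bilinear_dual_action: "bounded_bilinear (\<lambda>c (\<phi> :: 'a \<Rightarrow>\<^sub>L real). \<phi> o\<^sub>L smul_blinfun c)"
proof
  fix a b :: 'k and \<phi> \<psi> :: "'a \<Rightarrow>\<^sub>L real" and r :: real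
  show "\<phi> o\<^sub>L smul_blinfun (a + b) = (\<phi> o\<^sub>L smul_blinfun a) + (\<phi> o\<^sub>L smul_blinfun b)"
    by (rule blinfun_eqI) (simp add: smul_blinfun_apply blinfun.add_left blinfun.add_right scale_left_distrib)
  show "(\<phi> + \<psi>) o\<^sub>L smul_blinfun a = (\<phi> o\<^sub>L smul_blinfun a) + (\<psi> o\<^sub>L smul_blinfun a)"
    by (rule blinfun_eqI) (simp add: blinfun.add_left)
  show "\<phi> o\<^sub>L smul_blinfun (r *\<^sub>R a) = r *\<^sub>R (\<phi> o\<^sub>L smul_blinfun a)"
    by (rule blinfun_eqI) (simp add: smul_blinfun_apply blinfun.scaleR_left blinfun.scaleR_right
        bounded_bilinear.scaleR_left[OF bounded_bilinear_smul])
  show "(r *\<^sub>R \<phi>) o\<^sub>L smul_blinfun a = r *\<^sub>R (\<phi> o\<^sub>L smul_blinfun a)"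
    by (rule blinfun_eqI) (simp add: blinfun.scaleR_left)
  have "norm (\<phi> o\<^sub>L smul_blinfun a) \<le> norm a * norm \<phi> * 1" for a \<phi>
  proof -
    have "norm (smul_blinfun a) \<le> norm a"
      by (rule norm_blinfun_bound) (simp_all add: smul_blinfun_apply norm_scale)
    then have "norm \<phi> * norm (smul_blinfun a) \<le> norm \<phi> * norm a" by (intro mult_left_mono) auto
    then show ?thesis using norm_blinfun_compose[of \<phi> "smul_blinfun a"] by (simp add: mult.commute)
  qed
  then show "\<exists>K. \<forall>a \<phi>. norm (\<phi> o\<^sub>L smul_blinfun a) \<le> norm a * norm \<phi> * K" by blast
qed

text \<open>
  For dense \<open>Q\<close> the closures of such \<open>A\<close> and \<open>B\<close> are \<open>\<K>\<close>-subspaces of the space and of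
  its dual that norm each other; for countable \<open>Q\<close> the sets \<open>A\<close> and \<open>B\<close> can be countable.
\<close>

definition duality_closed :: "'k set \<Rightarrow> 'a set \<Rightarrow> ('a \<Rightarrow>\<^sub>L real) set \<Rightarrow> bool" where
  "duality_closed Q A B \<longleftrightarrow>
    0 \<in> A \<and> (\<forall>x\<in>A. \<forall>y\<in>A. x + y \<in> A) \<and> (\<forall>q\<in>Q. \<forall>x\<in>A. smul q x \<in> A) \<and>
    0 \<in> B \<and> (\<forall>\<phi>\<in>B. \<forall>\<psi>\<in>B. \<phi> + \<psi> \<in> B) \<and> (\<forall>q\<in>Q. \<forall>\<phi>\<in>B. (\<phi> o\<^sub>L smul_blinfun q) \<in> B) \<and>
    (\<forall>x\<in>A. \<exists>\<phi>\<in>B. norm \<phi> \<le> 1 \<and> blinfun_apply \<phi> x = norm x) \<and>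
    (\<forall>\<phi>\<in>B. \<exists>x\<in>A. norm x \<le> 1 \<and> blinfun_apply \<phi> x = norm \<phi>)"

text \<open>
  Closing off under countably many operations keeps sets countable. Working with subsets of the
  product of the space and its dual makes the exchange of norming vectors and norming functionals a
  single operation; in a reflexive space functionals attain their norm, so one vector suffices for each.
\<close>

lemma duality_closed_hull:
  fixes S :: "'a set" and T :: "('a \<Rightarrow>\<^sub>L real) set"
  assumes refl: "\<And>F :: ('a \<Rightarrow>\<^sub>L real) \<Rightarrow>\<^sub>L real. \<exists>x. \<forall>\<phi>. blinfun_apply F \<phi> = blinfun_apply \<phi> x"
    and Q: "countable Q" and S: "countable S" and T: "countable T"
  shows "\<exists>A B. duality_closed Q A B \<and> countable A \<and> countable B \<and> S \<subseteq> A \<and> T \<subseteq> B"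
proof -
  obtain d :: "'a \<Rightarrow> 'a \<Rightarrow>\<^sub>L real" where d: "\<And>x. norm (d x) \<le> 1" "\<And>x. blinfun_apply (d x) x = norm x"
    using norming_functional by metis
  have "\<exists>x. norm x \<le> 1 \<and> blinfun_apply \<phi> x = norm \<phi>" for \<phi> :: "'a \<Rightarrow>\<^sub>L real"
  proof -
    obtain F :: "('a \<Rightarrow>\<^sub>L real) \<Rightarrow>\<^sub>L real" where F: "norm F \<le> 1" "blinfun_apply F \<phi> = norm \<phi>"
      using norming_functional by blast
    obtain x where x: "\<And>\<phi>. blinfun_apply F \<phi> = blinfun_apply \<phi> x" using refl by blast
    have "norm x = blinfun_apply F (d x)" by (simp add: x d)
    also have "\<dots> \<le> norm F * norm (d x)" using norm_blinfun[of F "d x"] by simp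
    also have "\<dots> \<le> 1" using F(1) d(1)[of x] by (intro mult_le_one) auto
    finally show ?thesis using F(2) x by auto
  qed
  then obtain d' where d': "\<And>\<phi> :: 'a \<Rightarrow>\<^sub>L real. norm (d' \<phi>) \<le> 1" "\<And>\<phi>. blinfun_apply \<phi> (d' \<phi>) = norm \<phi>"
    by metis
  define enlarge where "enlarge G = G \<union> (\<lambda>(p, p'). p + p') ` (G \<times> G) \<union>
      (\<lambda>(q, x, \<phi>). (smul q x, \<phi> o\<^sub>L smul_blinfun q)) ` (Q \<times> G) \<union> (\<lambda>(x, \<phi>). (d' \<phi>, d x)) ` G" for G
  define G where "G n = (enlarge ^^ n) (insert 0 (S \<times> {0} \<union> {0} \<times> T))" for n
  have G_Suc: "G (Suc n) = enlarge (G n)" for n by (simp add: G_def)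
  have G_count: "countable (G n)" for n
  proof (induction n)
    case 0
    then show ?case using S T by (simp add: G_def)
  next
    case (Suc n)
    then show ?case unfolding G_Suc enlarge_def using Q by (intro countable_Un countable_image countable_SIGMA) auto
  qed
  have G_mono: "G m \<subseteq> G n" if "m \<le> n" for m n
    by (rule lift_Suc_mono_le[of G, OF _ that]) (unfold G_Suc enlarge_def, blast)
  define U where "U = (\<Union>n. G n)"
  have U0: "insert 0 (S \<times> {0} \<union> {0} \<times> T) \<subseteq> U"
    using UN_upper[of 0 UNIV G] by (simp add: U_def G_def)
  have U_add: "p + p' \<in> U" if "p \<in> U" "p' \<in> U" for p p'
  proof -
    from that obtain m n where "p \<in> G m" "p' \<in> G n" unfolding U_def by blast
    then have "p \<in> G (max m n)" "p' \<in> G (max m n)"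
      using G_mono[of m "max m n"] G_mono[of n "max m n"] by auto
    then have "p + p' \<in> G (Suc (max m n))" unfolding G_Suc enlarge_def by force
    then show ?thesis unfolding U_def by blast
  qed
  have U_scale: "(smul q x, \<phi> o\<^sub>L smul_blinfun q) \<in> U" if "q \<in> Q" "(x, \<phi>) \<in> U" for q x \<phi>
  proof -
    from that obtain n where "(x, \<phi>) \<in> G n" unfolding U_def by blast
    then have "(smul q x, \<phi> o\<^sub>L smul_blinfun q) \<in> G (Suc n)" unfolding G_Suc enlarge_def using that(1) by force
    then show ?thesis unfolding U_def by blast
  qed
  have U_dual: "(d' \<phi>, d x) \<in> U" if "(x, \<phi>) \<in> U" for x \<phi>
  proof -
    from that obtain n where "(x, \<phi>) \<in> G n" unfolding U_def by blast
    then have "(d' \<phi>, d x) \<in> G (Suc n)" unfolding G_Suc enlarge_def by force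
    then show ?thesis unfolding U_def by blast
  qed
  have "duality_closed Q (fst ` U) (snd ` U)"
    unfolding duality_closed_def
  proof (intro conjI ballI)
    show "0 \<in> fst ` U" "0 \<in> snd ` U" using U0 by force+
    fix x y assume "x \<in> fst ` U" "y \<in> fst ` U" then show "x + y \<in> fst ` U" using U_add by force
  next
    fix q x assume "q \<in> Q" "x \<in> fst ` U" then show "smul q x \<in> fst ` U" using U_scale by force
  next
    fix x y assume "x \<in> snd ` U" "y \<in> snd ` U" then show "x + y \<in> snd ` U" using U_add by force
  next
    fix q x assume "q \<in> Q" "x \<in> snd ` U" then show "x o\<^sub>L smul_blinfun q \<in> snd ` U" using U_scale by force
  next
    fix x assume "x \<in> fst ` U" then show "\<exists>\<phi>\<in>snd ` U. norm \<phi> \<le> 1 \<and> blinfun_apply \<phi> x = norm x"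
      using U_dual d by force
  next
    fix \<phi> assume "\<phi> \<in> snd ` U" then show "\<exists>x\<in>fst ` U. norm x \<le> 1 \<and> blinfun_apply \<phi> x = norm \<phi>"
      using U_dual d' by force
  qed
  moreover have "countable U" unfolding U_def using G_count by (intro countable_UN) auto
  moreover have "S \<subseteq> fst ` U" "T \<subseteq> snd ` U" using U0 by force+
  ultimately show ?thesis by (intro exI[of _ "fst ` U"] exI[of _ "snd ` U"]) auto
qed

lemma duality_closed_Union:
  assumes "\<And>n. duality_closed Q (A n) (B n)" and mono: "\<And>n. A n \<subseteq> A (Suc n)" "\<And>n. B n \<subseteq> B (Suc n)"
  shows "duality_closed Q (\<Union>n. A n) (\<Union>n :: nat. B n)"
proof -
  have A_mono: "A m \<subseteq> A n" and B_mono: "B m \<subseteq> B n" if "m \<le> n" for m n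
    using lift_Suc_mono_le[of A, OF mono(1) that] lift_Suc_mono_le[of B, OF mono(2) that] by auto
  have dc: "0 \<in> A n" "\<And>x y. x \<in> A n \<Longrightarrow> y \<in> A n \<Longrightarrow> x + y \<in> A n" "\<And>q x. q \<in> Q \<Longrightarrow> x \<in> A n \<Longrightarrow> smul q x \<in> A n"
    "0 \<in> B n" "\<And>\<phi> \<psi>. \<phi> \<in> B n \<Longrightarrow> \<psi> \<in> B n \<Longrightarrow> \<phi> + \<psi> \<in> B n" "\<And>q \<phi>. q \<in> Q \<Longrightarrow> \<phi> \<in> B n \<Longrightarrow> (\<phi> o\<^sub>L smul_blinfun q) \<in> B n"
    "\<And>x. x \<in> A n \<Longrightarrow> \<exists>\<phi>\<in>B n. norm \<phi> \<le> 1 \<and> blinfun_apply \<phi> x = norm x"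
    "\<And>\<phi>. \<phi> \<in> B n \<Longrightarrow> \<exists>x\<in>A n. norm x \<le> 1 \<and> blinfun_apply \<phi> x = norm \<phi>" for n
    using assms(1)[of n] unfolding duality_closed_def by blast+
  show ?thesis
    unfolding duality_closed_def
  proof (intro conjI ballI)
    fix x y assume "x \<in> (\<Union>n. A n)" "y \<in> (\<Union>n. A n)"
    then obtain m n where "x \<in> A m" "y \<in> A n" by blast
    then have "x \<in> A (max m n)" "y \<in> A (max m n)" using A_mono[of m "max m n"] A_mono[of n "max m n"] by auto
    then show "x + y \<in> (\<Union>n. A n)" using dc(2) by blast
  next
    fix \<phi> \<psi> assume "\<phi> \<in> (\<Union>n. B n)" "\<psi> \<in> (\<Union>n. B n)"
    then obtain m n where "\<phi> \<in> B m" "\<psi> \<in> B n" by blast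
    then have "\<phi> \<in> B (max m n)" "\<psi> \<in> B (max m n)" using B_mono[of m "max m n"] B_mono[of n "max m n"] by auto
    then show "\<phi> + \<psi> \<in> (\<Union>n. B n)" using dc(5) by blast
  next
    fix x assume "x \<in> (\<Union>n. A n)"
    then obtain n where "x \<in> A n" by blast
    from dc(7)[OF this] show "\<exists>\<phi>\<in>(\<Union>n. B n). norm \<phi> \<le> 1 \<and> blinfun_apply \<phi> x = norm x" by blast
  next
    fix \<phi> assume "\<phi> \<in> (\<Union>n. B n)"
    then obtain n where "\<phi> \<in> B n" by blast
    from dc(8)[OF this] show "\<exists>x\<in>(\<Union>n. A n). norm x \<le> 1 \<and> blinfun_apply \<phi> x = norm \<phi>" by blast
  next
    show "0 \<in> (\<Union>n. A n)" "0 \<in> (\<Union>n. B n)" using dc(1,4) by auto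
  next
    fix q x assume "q \<in> Q" "x \<in> (\<Union>n. A n)"
    then show "smul q x \<in> (\<Union>n. A n)" using dc(3) by auto
  next
    fix q \<phi> assume "q \<in> Q" "\<phi> \<in> (\<Union>n. B n)"
    then show "\<phi> o\<^sub>L smul_blinfun q \<in> (\<Union>n. B n)" using dc(6) by auto
  qed
qed

text \<open>
  Let \<open>Y\<close> be the closure of \<open>A\<close> and \<open>Z\<close> the annihilator of \<open>B\<close>. Since \<open>B\<close> norms \<open>Y\<close>, the projection
  of \<open>Y + Z\<close> onto \<open>Y\<close> along \<open>Z\<close> has norm at most one and \<open>Y + Z\<close> is closed. A functional \<open>\<phi>\<close>
  vanishing on \<open>Y + Z\<close> belongs to the closure of \<open>B\<close>: by reflexivity a closed subspace of the dual is
  the annihilator of its annihilator. As \<open>A\<close> norms \<open>B\<close>, \<open>\<phi>\<close> is zero, and \<open>Y + Z\<close> is the whole space.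
\<close>

theorem duality_closed_projection:
  fixes A :: "'a set" and B :: "('a \<Rightarrow>\<^sub>L real) set"
  assumes refl: "\<And>F :: ('a \<Rightarrow>\<^sub>L real) \<Rightarrow>\<^sub>L real. \<exists>x. \<forall>\<phi>. blinfun_apply F \<phi> = blinfun_apply \<phi> x"
    and Q: "closure Q = UNIV" and AB: "duality_closed Q A B"
  shows "\<exists>P :: 'a \<Rightarrow>\<^sub>L 'a. norm P \<le> 1 \<and> (\<forall>c x. blinfun_apply P (smul c x) = smul c (blinfun_apply P x)) \<and>
     (\<forall>x. blinfun_apply P x \<in> closure A) \<and> (\<forall>x\<in>closure A. blinfun_apply P x = x) \<and>
     (\<forall>x. \<forall>\<phi>\<in>B. blinfun_apply \<phi> (blinfun_apply P x) = blinfun_apply \<phi> x) \<and>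
     (\<forall>x. (\<forall>\<phi>\<in>B. blinfun_apply \<phi> x = 0) \<longrightarrow> blinfun_apply P x = 0)"
proof -
  define Y where "Y = closure A"
  define N where "N = closure B"
  define Z where "Z = {x. \<forall>\<phi>\<in>B. blinfun_apply \<phi> x = 0}"
  have A: "0 \<in> A" "\<forall>x\<in>A. \<forall>y\<in>A. x + y \<in> A" "\<forall>q\<in>Q. \<forall>x\<in>A. smul q x \<in> A"
    and B: "0 \<in> B" "\<forall>\<phi>\<in>B. \<forall>\<psi>\<in>B. \<phi> + \<psi> \<in> B" "\<forall>q\<in>Q. \<forall>\<phi>\<in>B. (\<phi> o\<^sub>L smul_blinfun q) \<in> B"
    and AB_norm: "\<And>x. x \<in> A \<Longrightarrow> \<exists>\<phi>\<in>B. norm \<phi> \<le> 1 \<and> blinfun_apply \<phi> x = norm x"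
    and BA_norm: "\<And>\<phi>. \<phi> \<in> B \<Longrightarrow> \<exists>x\<in>A. norm x \<le> 1 \<and> blinfun_apply \<phi> x = norm \<phi>"
    using AB unfolding duality_closed_def by blast+
  note Y_lin = closure_closed_under_scaling[OF bounded_bilinear_smul Q A(2,3), folded Y_def]
  note N_lin = closure_closed_under_scaling[OF bounded_bilinear_dual_action Q B(2,3), folded N_def]
  have Y0: "0 \<in> Y" unfolding Y_def using A(1) closure_subset by blast
  have Y_scaleR: "r *\<^sub>R x \<in> Y" if "x \<in> Y" for r x
    using Y_lin(2)[OF that, of "of_real r"] by (simp add: scale_of_real)
  have sub_Y: "Real_Vector_Spaces.subspace Y" using Y0 Y_lin(1) Y_scaleR by (auto simp: real_vector.subspace_def)
  have sub_N: "Real_Vector_Spaces.subspace N"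
    unfolding real_vector.subspace_def
  proof (intro conjI ballI allI)
    show "0 \<in> N" unfolding N_def using B(1) closure_subset by blast
    fix \<phi> assume \<phi>: "\<phi> \<in> N"
    show "\<phi> + \<psi> \<in> N" if "\<psi> \<in> N" for \<psi> using N_lin(1)[OF \<phi> that] .
    fix r :: real
    have "r *\<^sub>R \<phi> = \<phi> o\<^sub>L smul_blinfun (of_real r)"
      by (rule blinfun_eqI) (simp add: smul_blinfun_apply scale_of_real blinfun.scaleR_left blinfun.scaleR_right)
    then show "r *\<^sub>R \<phi> \<in> N" using N_lin(2)[OF \<phi>] by simp
  qed
  have Z_N: "blinfun_apply \<phi> z = 0" if "\<phi> \<in> N" "z \<in> Z" for \<phi> z
  proof -
    have "closed {\<phi> :: 'a \<Rightarrow>\<^sub>L real. blinfun_apply \<phi> z = 0}"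
      by (intro closed_Collect_eq continuous_intros)
    then have "N \<subseteq> {\<phi>. blinfun_apply \<phi> z = 0}"
      unfolding N_def using that(2) by (intro closure_minimal) (auto simp: Z_def)
    then show ?thesis using that(1) by blast
  qed
  have B_N: "B \<subseteq> N" unfolding N_def by (rule closure_subset)
  have sub_Z: "Real_Vector_Spaces.subspace Z"
    by (auto simp: Z_def real_vector.subspace_def blinfun.add_right blinfun.scaleR_right)
  have Z_smul: "smul c z \<in> Z" if "z \<in> Z" for c z
    unfolding Z_def
  proof (safe)
    fix \<phi> assume "\<phi> \<in> B"
    then have "\<phi> o\<^sub>L smul_blinfun c \<in> N" using B_N N_lin(2) by blast
    from Z_N[OF this that] show "blinfun_apply \<phi> (smul c z) = 0" by (simp add: smul_blinfun_apply)
  qed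
  have closed_Z: "closed Z"
  proof -
    have "Z = (\<Inter>\<phi>\<in>B. {x. blinfun_apply \<phi> x = 0})" by (auto simp: Z_def)
    then show ?thesis by (auto intro!: closed_INT closed_Collect_eq continuous_intros)
  qed
  have norm_le: "norm y \<le> norm (y + z)" if "y \<in> Y" "z \<in> Z" for y z
  proof -
    have "norm a \<le> norm (a + z)" if a: "a \<in> A" for a
    proof -
      obtain \<phi> where \<phi>: "\<phi> \<in> B" "norm \<phi> \<le> 1" "blinfun_apply \<phi> a = norm a" using AB_norm[OF a] by blast
      have "norm a = blinfun_apply \<phi> (a + z)" using \<phi> \<open>z \<in> Z\<close> by (simp add: blinfun.add_right Z_def)
      also have "\<dots> \<le> norm \<phi> * norm (a + z)" using norm_blinfun[of \<phi> "a + z"] by simp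
      also have "\<dots> \<le> norm (a + z)" using \<phi>(2) by (intro mult_left_le_one_le) auto
      finally show ?thesis .
    qed
    then have "Y \<subseteq> {y. norm y \<le> norm (y + z)}"
      unfolding Y_def by (intro closure_minimal closed_Collect_le continuous_intros) auto
    then show ?thesis using that(1) by blast
  qed
  have sub_YZ: "Real_Vector_Spaces.subspace {y + z | y z. y \<in> Y \<and> z \<in> Z}" using sub_Y sub_Z by (rule real_vector.subspace_sums)
  have closed_YZ: "closed {y + z | y z. y \<in> Y \<and> z \<in> Z}"
    unfolding closed_sequential_limits
  proof (intro allI impI)
    fix s l assume "(\<forall>n. s n \<in> {y + z | y z. y \<in> Y \<and> z \<in> Z}) \<and> s \<longlonglongrightarrow> l"
    then obtain y z where yz: "\<And>n :: nat. s n = y n + z n" "\<And>n. y n \<in> Y" "\<And>n. z n \<in> Z" and l: "s \<longlonglongrightarrow> l"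
      by (auto simp: mem_Collect_eq) metis
    have "norm (y m - y n) \<le> norm (s m - s n)" for m n
      using norm_le[OF real_vector.subspace_diff[OF sub_Y yz(2,2)] real_vector.subspace_diff[OF sub_Z yz(3,3)], of m n m n]
      by (simp add: yz(1) algebra_simps)
    then have "Cauchy y"
      using LIMSEQ_imp_Cauchy[OF l] unfolding Cauchy_def dist_norm by (meson le_less_trans)
    then obtain y' where y': "y \<longlonglongrightarrow> y'" using Cauchy_convergent_iff convergent_def by blast
    have "y' \<in> Y" using closed_sequentially[OF _ yz(2) y'] by (simp add: Y_def)
    moreover have z_lim: "z \<longlonglongrightarrow> l - y'"
      using tendsto_diff[OF l y'] by (simp add: yz(1))
    have "l - y' \<in> Z" by (rule closed_sequentially[OF closed_Z yz(3) z_lim])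
    ultimately have "l = y' + (l - y') \<and> y' \<in> Y \<and> l - y' \<in> Z" by simp
    then show "l \<in> {y + z | y z. y \<in> Y \<and> z \<in> Z}" by blast
  qed
  have decomp: "\<exists>y\<in>Y. x - y \<in> Z" for x
  proof (rule ccontr)
    assume "\<not> ?thesis"
    then have "x \<notin> {y + z | y z. y \<in> Y \<and> z \<in> Z}" by force
    from separating_functional[OF sub_YZ closed_YZ this] obtain \<phi> :: "'a \<Rightarrow>\<^sub>L real" where
      \<phi>: "\<forall>v\<in>{y + z | y z. y \<in> Y \<and> z \<in> Z}. blinfun_apply \<phi> v = 0" "blinfun_apply \<phi> x > 0" by (elim exE conjE)
    have \<phi>_sum: "blinfun_apply \<phi> (y + z) = 0" if "y \<in> Y" "z \<in> Z" for y z
      using that by (intro \<phi>(1)[rule_format]) blast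
    have \<phi>_Y: "blinfun_apply \<phi> y = 0" if "y \<in> Y" for y
      using \<phi>_sum[OF that real_vector.subspace_0[OF sub_Z]] by simp
    have \<phi>_Z: "blinfun_apply \<phi> z = 0" if "z \<in> Z" for z
      using \<phi>_sum[OF Y0 that] by simp
    have "\<phi> \<in> N"
    proof (rule ccontr)
      assume "\<phi> \<notin> N"
      moreover have "closed N" by (simp add: N_def)
      ultimately obtain F :: "('a \<Rightarrow>\<^sub>L real) \<Rightarrow>\<^sub>L real" where F: "\<forall>\<psi>\<in>N. blinfun_apply F \<psi> = 0" "blinfun_apply F \<phi> > 0"
        using separating_functional[OF sub_N] by blast
      obtain v where v: "\<And>\<psi>. blinfun_apply F \<psi> = blinfun_apply \<psi> v" using refl by blast
      then have "v \<in> Z" using F(1) B_N by (auto simp: Z_def)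
      then show False using \<phi>_Z F(2) v by simp
    qed
    \<comment> \<open>\<open>A\<close> norms \<open>B\<close>, and \<open>\<phi>\<close> is zero on \<open>A\<close> but close to elements of \<open>B\<close>.\<close>
    have "norm \<phi> < e" if "0 < e" for e
    proof -
      obtain \<psi> where \<psi>: "\<psi> \<in> B" "norm (\<psi> - \<phi>) < e / 2"
        using \<open>\<phi> \<in> N\<close> \<open>0 < e\<close> unfolding N_def closure_approachable dist_norm by (meson half_gt_zero)
      obtain a where a: "a \<in> A" "norm a \<le> 1" "blinfun_apply \<psi> a = norm \<psi>" using BA_norm[OF \<psi>(1)] by blast
      have "a \<in> Y" using a(1) closure_subset unfolding Y_def by blast
      then have "norm \<psi> = blinfun_apply (\<psi> - \<phi>) a" using a(3) \<phi>_Y by (simp add: blinfun.diff_left)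
      also have "\<dots> \<le> norm (\<psi> - \<phi>) * norm a" using norm_blinfun[of "\<psi> - \<phi>" a] by simp
      also have "\<dots> \<le> norm (\<psi> - \<phi>)" using a(2) by (intro mult_left_le) auto
      finally have "norm \<psi> < e / 2" using \<psi>(2) by simp
      then show ?thesis using norm_triangle_ineq2[of \<phi> \<psi>] \<psi>(2) by (simp add: norm_minus_commute)
    qed
    from this[of "norm \<phi>"] have "\<phi> = 0" by (cases "\<phi> = 0") auto
    then show False using \<phi>(2) by simp
  qed
  define p where "p x = (SOME y. y \<in> Y \<and> x - y \<in> Z)" for x
  have p: "p x \<in> Y" "x - p x \<in> Z" for x
    using someI_ex[of "\<lambda>y. y \<in> Y \<and> x - y \<in> Z"] decomp[of x] unfolding p_def by blast+
  have p_eq: "p x = y" if "y \<in> Y" "x - y \<in> Z" for x y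
  proof -
    have "norm (y - p x) \<le> norm ((y - p x) + ((x - y) - (x - p x)))"
      by (rule norm_le[OF real_vector.subspace_diff[OF sub_Y that(1) p(1)]
            real_vector.subspace_diff[OF sub_Z that(2) p(2)]])
    then show ?thesis by simp
  qed
  have p_add: "p (x + y) = p x + p y" for x y
  proof (rule p_eq)
    have "(x - p x) + (y - p y) \<in> Z" using p by (intro real_vector.subspace_add[OF sub_Z])
    then show "x + y - (p x + p y) \<in> Z" by (simp add: algebra_simps)
  qed (use p Y_lin in auto)
  have p_smul: "p (smul c x) = smul c (p x)" for c x
  proof (rule p_eq)
    show "smul c x - smul c (p x) \<in> Z" using Z_smul[OF p(2), of c x] by (simp add: scale_right_diff_distrib)
  qed (use p Y_lin in auto)
  have p_norm: "norm (p x) \<le> 1 * norm x" for x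
    using norm_le[OF p(1) p(2), of x x] by simp
  have bl: "bounded_linear p"
    using p_norm p_add p_smul[of "of_real _"]
    by (intro bounded_linear_intro[of _ 1]) (simp_all add: scale_of_real)
  show ?thesis
  proof (intro exI[of _ "Blinfun p"] conjI allI ballI impI, unfold bounded_linear_Blinfun_apply[OF bl])
    show "norm (Blinfun p) \<le> 1"
      using p_norm by (intro norm_blinfun_bound) (simp_all add: bounded_linear_Blinfun_apply[OF bl])
    show "p (smul c x) = smul c (p x)" for c x by (rule p_smul)
    show "p x \<in> closure A" for x using p(1) by (simp add: Y_def)
    show "p x = x" if "x \<in> closure A" for x
      using that real_vector.subspace_0[OF sub_Z] by (intro p_eq) (simp_all add: Y_def)
    show "blinfun_apply \<phi> (p x) = blinfun_apply \<phi> x" if "\<phi> \<in> B" for x \<phi>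
      using p(2)[of x] that by (simp add: Z_def blinfun.diff_right)
    show "p x = 0" if "\<forall>\<phi>\<in>B. blinfun_apply \<phi> x = 0" for x
      using that Y0 by (intro p_eq) (simp_all add: Z_def)
  qed
qed

text \<open>
  The operators are \<open>P' - P n\<close> for increasing projections \<open>P n\<close> and the projection \<open>P'\<close> that belongs to
  the union of the chain. Nonseparability lets the ranges grow strictly at every step, so there are
  vectors fixed by \<open>P'\<close> and annihilated by any given finite number of the \<open>P n\<close>.
\<close>

theorem reflexive_not_separable_projections:
  assumes refl: "\<And>F :: ('a \<Rightarrow>\<^sub>L real) \<Rightarrow>\<^sub>L real. \<exists>x. \<forall>\<phi>. blinfun_apply F \<phi> = blinfun_apply \<phi> x"
    and sep: "\<not> separable_space (euclidean :: 'a topology)"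
  shows "\<exists>T :: nat \<Rightarrow> 'a \<Rightarrow>\<^sub>L 'a. (\<forall>n. norm (T n) \<le> 2) \<and>
    (\<forall>n c x. blinfun_apply (T n) (smul c x) = smul c (blinfun_apply (T n) x)) \<and>
    (\<forall>x. (\<lambda>n. blinfun_apply (T n) x) \<longlonglongrightarrow> 0) \<and>
    (\<forall>N. \<exists>x. norm x = 1 \<and> (\<forall>n\<le>N. blinfun_apply (T n) x = x))"
proof -
  obtain Q :: "'k set" where Q: "countable Q" "closure Q = UNIV" using scalars_countable_dense by blast
  define good where "good = (\<lambda>(A :: 'a set, B). duality_closed Q A B \<and> countable A \<and> countable B)"
  define ext where "ext = (\<lambda>(A :: 'a set, B :: ('a \<Rightarrow>\<^sub>L real) set) (A', B'). A \<subseteq> A' \<and> B \<subseteq> B' \<and> (\<exists>x\<in>A'. x \<notin> closure A))"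
  have "\<exists>s. \<forall>n. good (s n) \<and> ext (s n) (s (Suc n))"
  proof (rule dependent_nat_choice[where P = "\<lambda>_. good" and Q = "\<lambda>_. ext"])
    show "\<exists>s. good s"
      using duality_closed_hull[OF refl Q(1), of "{}" "{}"] unfolding good_def by auto
  next
    fix s and n :: nat assume "good s"
    then obtain A B where s: "s = (A, B)" and AB: "countable A" "countable B" unfolding good_def by auto
    have "closure A \<noteq> UNIV" using sep AB(1) by (auto simp: separable_space_def)
    then obtain x where x: "x \<notin> closure A" by blast
    obtain A' B' where "duality_closed Q A' B'" "countable A'" "countable B'" "insert x A \<subseteq> A'" "B \<subseteq> B'"
      using duality_closed_hull[OF refl Q(1), of "insert x A" B] AB by auto
    then show "\<exists>s'. good s' \<and> ext s s'"
      using x unfolding good_def ext_def s by (intro exI[of _ "(A', B')"]) auto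
  qed
  then obtain s where s: "\<And>n. good (s n)" "\<And>n. ext (s n) (s (Suc n))" by blast
  define A B where "A n = fst (s n)" and "B n = snd (s n)" for n
  have dc: "duality_closed Q (A n) (B n)" for n using s(1)[of n] by (auto simp: good_def A_def B_def split: prod.splits)
  have step: "A n \<subseteq> A (Suc n)" "B n \<subseteq> B (Suc n)" "\<exists>x\<in>A (Suc n). x \<notin> closure (A n)" for n
    using s(2)[of n] by (auto simp: ext_def A_def B_def split: prod.splits)
  have A_mono: "A m \<subseteq> A n" and B_mono: "B m \<subseteq> B n" if "m \<le> n" for m n
    using lift_Suc_mono_le[of A, OF step(1) that] lift_Suc_mono_le[of B, OF step(2) that] by auto
  define A' B' where "A' = (\<Union>n. A n)" and "B' = (\<Union>n. B n)"
  have sub: "A n \<subseteq> A'" "B n \<subseteq> B'" for n by (auto simp: A'_def B'_def)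
  obtain P :: "nat \<Rightarrow> 'a \<Rightarrow>\<^sub>L 'a" where P:
     "\<And>n. norm (P n) \<le> 1" "\<And>n c x. blinfun_apply (P n) (smul c x) = smul c (blinfun_apply (P n) x)"
     "\<And>n x. blinfun_apply (P n) x \<in> closure (A n)" "\<And>n x. x \<in> closure (A n) \<Longrightarrow> blinfun_apply (P n) x = x"
     "\<And>n x \<phi>. \<phi> \<in> B n \<Longrightarrow> blinfun_apply \<phi> (blinfun_apply (P n) x) = blinfun_apply \<phi> x"
     "\<And>n x. (\<And>\<phi>. \<phi> \<in> B n \<Longrightarrow> blinfun_apply \<phi> x = 0) \<Longrightarrow> blinfun_apply (P n) x = 0"
    using duality_closed_projection[OF refl Q(2) dc] by metis
  have "duality_closed Q A' B'" unfolding A'_def B'_def using dc step(1,2) by (rule duality_closed_Union)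
  from duality_closed_projection[OF refl Q(2) this] obtain P' :: "'a \<Rightarrow>\<^sub>L 'a" where P':
     "norm P' \<le> 1" "\<forall>c x. blinfun_apply P' (smul c x) = smul c (blinfun_apply P' x)"
     "\<forall>x. blinfun_apply P' x \<in> closure A'" "\<forall>x\<in>closure A'. blinfun_apply P' x = x"
     "\<forall>x. \<forall>\<phi>\<in>B'. blinfun_apply \<phi> (blinfun_apply P' x) = blinfun_apply \<phi> x" by (elim exE conjE)
  show ?thesis
  proof (intro exI[of _ "\<lambda>n. P' - P n"] conjI allI)
    show "norm (P' - P n) \<le> 2" for n
      using norm_triangle_ineq4[of P' "P n"] P(1)[of n] P'(1) by simp
    show "blinfun_apply (P' - P n) (smul c x) = smul c (blinfun_apply (P' - P n) x)" for n c x
      by (simp add: blinfun.diff_left P(2) P'(2) scale_right_diff_distrib)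
  next
    fix x
    let ?y = "blinfun_apply P' x"
    have "blinfun_apply (P n) (x - ?y) = 0" for n
      using sub(2)[of n] P'(5) by (intro P(6)) (auto simp: blinfun.diff_right dest!: subsetD)
    then have T_eq: "blinfun_apply (P' - P n) x = ?y - blinfun_apply (P n) ?y" for n
      by (simp add: blinfun.diff_left blinfun.diff_right)
    show "(\<lambda>n. blinfun_apply (P' - P n) x) \<longlonglongrightarrow> 0"
      unfolding T_eq
    proof (rule LIMSEQ_I)
      fix e :: real assume "0 < e"
      then obtain a where a: "a \<in> A'" "norm (a - ?y) < e / 2"
        using P'(3)[rule_format, of x] unfolding closure_approachable dist_norm by (meson half_gt_zero)
      then obtain m where m: "a \<in> A m" by (auto simp: A'_def)
      have "norm (?y - blinfun_apply (P n) ?y - 0) < e" if "m \<le> n" for n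
      proof -
        have "a \<in> closure (A n)" using m A_mono[OF that] closure_subset by blast
        then have "?y - blinfun_apply (P n) ?y = blinfun_apply (P n) (a - ?y) - (a - ?y)"
          by (simp add: blinfun.diff_right P(4))
        also have "norm \<dots> \<le> norm (blinfun_apply (P n) (a - ?y)) + norm (a - ?y)" by (rule norm_triangle_ineq4)
        also have "\<dots> \<le> 2 * norm (a - ?y)"
          using norm_blinfun[of "P n" "a - ?y"] mult_right_mono[OF P(1)[of n], of "norm (a - ?y)"] by simp
        finally show ?thesis using a(2) by simp
      qed
      then show "\<exists>m. \<forall>n\<ge>m. norm (?y - blinfun_apply (P n) ?y - 0) < e" by blast
    qed
  next
    fix N
    obtain a where a: "a \<in> A (Suc N)" "a \<notin> closure (A N)" using step(3) by blast
    define x where "x = a - blinfun_apply (P N) a"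
    have "x \<noteq> 0" using a(2) P(3)[of N a] by (auto simp: x_def)
    have fix_x: "blinfun_apply (P' - P n) x = x" if "n \<le> N" for n
    proof -
      have "a \<in> closure A'" "blinfun_apply (P N) a \<in> closure A'"
        using a(1) sub(1) closure_subset[of A'] P(3)[of N a] closure_mono[OF sub(1)[of N]] by auto
      then have "blinfun_apply P' x = x" by (simp add: x_def blinfun.diff_right P'(4))
      moreover have "blinfun_apply (P n) x = 0"
        using B_mono[OF that] P(5)[of _ N a] by (intro P(6)) (auto simp: x_def blinfun.diff_right)
      ultimately show ?thesis by (simp add: blinfun.diff_left)
    qed
    show "\<exists>x. norm x = 1 \<and> (\<forall>n\<le>N. blinfun_apply (P' - P n) x = x)"
      using \<open>x \<noteq> 0\<close> fix_x by (intro exI[of _ "(1 / norm x) *\<^sub>R x"]) (simp add: blinfun.scaleR_right)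
  qed
qed

section \<open>Separability\<close>

text \<open>
  A unit vector fixed by \<open>u\<close>, together with a functional supporting it, is a state at which \<open>u\<close> has the
  value \<open>1\<close>. This is the gap needed for \<open>no_attained_limit\<close>; as the operators tend to \<open>0\<close> pointwise, the
  only cluster point to be considered is \<open>0\<close>.
\<close>

theorem NRA_imp_separable:
  assumes NRA: "operators smul = NRA smul"
    and refl: "\<And>F :: ('a \<Rightarrow>\<^sub>L real) \<Rightarrow>\<^sub>L real. \<exists>x. \<forall>\<phi>. blinfun_apply F \<phi> = blinfun_apply \<phi> x"
  shows "separable_space (euclidean :: 'a topology)"
proof (rule ccontr)
  assume "\<not> ?thesis"
  then obtain T :: "nat \<Rightarrow> 'a \<Rightarrow>\<^sub>L 'a" where T: "\<And>n. norm (T n) \<le> 2"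
    and T_smul: "\<And>n c x. blinfun_apply (T n) (smul c x) = smul c (blinfun_apply (T n) x)"
    and T_lim: "\<And>x. (\<lambda>n. blinfun_apply (T n) x) \<longlonglongrightarrow> 0"
    and T_fix: "\<And>N. \<exists>x. norm x = 1 \<and> (\<forall>n\<le>N. blinfun_apply (T n) x = x)"
    using reflexive_not_separable_projections[OF refl] by blast
  define W where "W = {(\<theta> :: 'k, y, g). norm \<theta> = 1 \<and> (y, g) \<in> states smul}"
  define ev where "ev = (\<lambda>(\<theta> :: 'k, y, g) (S :: 'a \<Rightarrow>\<^sub>L 'a). re (\<theta> * g (blinfun_apply S y)))"
  have lin: "linear (ev x)" if "x \<in> W" for x
  proof -
    from that obtain \<theta> y g where x: "x = (\<theta>, y, g)" "g \<in> dual smul" by (auto simp: W_def states_def)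
    interpret g: bounded_linear g using dual_bounded_linear[OF x(2)] .
    show ?thesis
      by (rule linearI) (simp_all add: x(1) ev_def blinfun.add_left blinfun.scaleR_left g.add g.scaleR
          distrib_left re_add re_scaleR)
  qed
  have ev_le: "\<bar>ev x S\<bar> \<le> norm (blinfun_apply S (fst (snd x)))" if "x \<in> W" for x S
  proof -
    from that obtain \<theta> y g where x: "x = (\<theta>, y, g)" "norm \<theta> = 1" "g \<in> dual smul" "onorm g = 1"
      by (auto simp: W_def states_def)
    have "\<bar>ev x S\<bar> \<le> norm (\<theta> * g (blinfun_apply S y))" unfolding x(1) ev_def by (simp add: abs_re_le_norm)
    also have "\<dots> \<le> norm (blinfun_apply S y)"
      using dual_norm_le[OF x(3), of "blinfun_apply S y"] by (simp add: norm_mult x(2,4))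
    finally show ?thesis by (simp add: x(1))
  qed
  show False
  proof (rule no_attained_limit[of W ev 1 T 2 "{0}" 1])
    show "W \<noteq> {}"
    proof -
      obtain y where y: "norm y = (1::real)" "y \<noteq> (0::'a)" using T_fix[of 0] by force
      then obtain g where "g \<in> dual smul" "onorm g = 1" "g y = of_real (norm y)" using support_functional by blast
      then have "(1, y, g) \<in> W" using y by (simp add: W_def states_def)
      then show ?thesis by blast
    qed
    show "linear (ev x)" if "x \<in> W" for x using lin[OF that] .
    show "\<bar>ev x S\<bar> \<le> 1 * norm S" if "x \<in> W" for x S
    proof -
      have "norm (fst (snd x)) = 1" using that by (auto simp: W_def states_def)
      then show ?thesis using ev_le[OF that, of S] norm_blinfun[of S "fst (snd x)"] by simp
    qed
    show "norm (T n) \<le> 2" for n by (rule T)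
    show "\<exists>w\<in>{0}. \<forall>x\<in>W. \<forall>e>0. \<exists>\<^sub>F n in sequentially. ev x (g n) < ev x w + e"
      if g: "\<And>n. g n \<in> convex hull (T ` {n..})" for g
    proof (intro bexI[of _ 0] ballI allI impI)
      fix x and e :: real assume x: "x \<in> W" and e: "0 < e"
      have "(\<lambda>n. norm (blinfun_apply (T n) (fst (snd x)))) \<longlonglongrightarrow> 0"
        using T_lim by (rule tendsto_norm_zero)
      then have "\<forall>\<^sub>F n in sequentially. norm (blinfun_apply (T n) (fst (snd x))) < e"
        using e by (rule order_tendstoD(2))
      then obtain N where N: "\<And>n. N \<le> n \<Longrightarrow> norm (blinfun_apply (T n) (fst (snd x))) < e"
        by (auto simp: eventually_sequentially)
      have "ev x (g n) < ev x 0 + e" if "N \<le> n" for n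
      proof -
        have "ev x (T m) < e" if "n \<le> m" for m
          using ev_le[OF x, of "T m"] N[of m] that \<open>N \<le> n\<close> by simp
        moreover have "convex {S. ev x S < e}"
          using convex_linear_vimage[OF lin[OF x], of "{..<e}"] by (simp add: vimage_def)
        ultimately have "convex hull (T ` {n..}) \<subseteq> {S. ev x S < e}" by (intro hull_minimal) auto
        then show ?thesis using g[of n] linear_0[OF lin[OF x]] by auto
      qed
      then have "\<forall>\<^sub>F n in sequentially. ev x (g n) < ev x 0 + e" by (auto simp: eventually_sequentially)
      then show "\<exists>\<^sub>F n in sequentially. ev x (g n) < ev x 0 + e" by (rule eventually_frequently[rotated]) simp
    qed simp
    show "(SUP x\<in>W. ev x (u - w)) = (SUP x\<in>W. ev x (u - w'))" if "w \<in> {0}" "w' \<in> {0}" for u w w'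
      using that by simp
    show "(0::real) < 1" by simp
    show "\<exists>x\<in>W. 1 \<le> ev x (u - w)" if w: "w \<in> {0}" and u: "u \<in> convex hull (range T)" for w u
    proof -
      obtain N where N: "u \<in> convex hull (T ` {..N})" using convex_hull_range_initial[OF u] by blast
      obtain y where y: "norm y = 1" "\<And>n. n \<le> N \<Longrightarrow> blinfun_apply (T n) y = y" using T_fix[of N] by blast
      have "convex {S :: 'a \<Rightarrow>\<^sub>L 'a. blinfun_apply S y = y}"
        by (auto simp: convex_def blinfun.add_left blinfun.scaleR_left simp flip: scaleR_add_left)
      then have "convex hull (T ` {..N}) \<subseteq> {S. blinfun_apply S y = y}"
        using y(2) by (intro hull_minimal) auto
      with N have uy: "blinfun_apply u y = y" by blast
      have "y \<noteq> 0" using y(1) by auto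
      then obtain g where g: "g \<in> dual smul" "onorm g = 1" "g y = of_real (norm y)" using support_functional by blast
      have "(1, y, g) \<in> W" using g y(1) by (simp add: W_def states_def)
      moreover have "ev (1, y, g) (u - w) = 1"
        using w by (simp add: ev_def uy g(3) y(1) re_def scalar_embedding_one)
      ultimately show ?thesis by force
    qed
    show "\<exists>x\<in>W. \<forall>y\<in>W. ev y (h - w) \<le> ev x (h - w)"
      if w: "w \<in> {0}" and h: "h \<in> closure (convex hull (range T))" for w h
    proof -
      \<comment> \<open>Limits of convex combinations are \<open>\<K>\<close>-linear again, so the hypothesis applies to \<open>h\<close>.\<close>
      have "closure (convex hull (range T)) \<subseteq> {S. \<forall>c x. blinfun_apply S (smul c x) = smul c (blinfun_apply S x)}"
      proof (intro closure_minimal hull_minimal)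
        show "range T \<subseteq> {S. \<forall>c x. blinfun_apply S (smul c x) = smul c (blinfun_apply S x)}"
          using T_smul by auto
        show "convex {S. \<forall>c x. blinfun_apply S (smul c x) = smul c (blinfun_apply S x)}"
          by (auto simp: convex_def blinfun.add_left blinfun.scaleR_left scale_right_distrib
              bounded_bilinear.scaleR_right[OF bounded_bilinear_smul])
        have "{S. \<forall>c x. blinfun_apply S (smul c x) = smul c (blinfun_apply S x)} =
          (\<Inter>c. \<Inter>x. {S. blinfun_apply S (smul c x) = blinfun_apply (smul_blinfun c) (blinfun_apply S x)})"
          by (auto simp: smul_blinfun_apply)
        then show "closed {S. \<forall>c x. blinfun_apply S (smul c x) = smul c (blinfun_apply S x)}"
          by (auto intro!: closed_INT closed_Collect_eq continuous_intros)
      qed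
      with h have "blinfun_apply h \<in> operators smul"
        by (auto simp: operators_iff blinfun.bounded_linear_right)
      then have h_op: "blinfun_apply h \<in> operators smul" and "blinfun_apply h \<in> NRA smul" using NRA by auto
      then obtain y g where yg: "(y, g) \<in> states smul" "numerical_radius smul (blinfun_apply h) = norm (g (blinfun_apply h y))"
        by (auto simp: NRA_def)
      obtain \<theta> where \<theta>: "norm \<theta> = 1" "\<theta> * g (blinfun_apply h y) = of_real (norm (g (blinfun_apply h y)))"
        using unit_rotation by blast
      have "ev v h \<le> ev (\<theta>, y, g) h" if v_W: "v \<in> W" for v
      proof -
        obtain \<theta>' y' g' where v: "v = (\<theta>', y', g')" "norm \<theta>' = 1" "(y', g') \<in> states smul"
          using v_W by (auto simp: W_def)
        have "ev v h \<le> norm (\<theta>' * g' (blinfun_apply h y'))" unfolding v(1) ev_def by (simp add: re_le_norm)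
        also have "\<dots> \<le> numerical_radius smul (blinfun_apply h)"
          using state_value_le_numerical_radius[OF h_op v(3)] by (simp add: norm_mult v(2))
        finally show ?thesis by (simp add: ev_def \<theta>(2) re_of_real yg(2))
      qed
      then have "\<forall>v\<in>W. ev v (h - w) \<le> ev (\<theta>, y, g) (h - w)" using w by simp
      moreover have "(\<theta>, y, g) \<in> W" using \<theta>(1) yg(1) by (simp add: W_def)
      ultimately show ?thesis by (rule bexI)
    qed
  qed
qed

end

theorem proposition2p4:
  fixes smul :: "'k::real_or_complex_field \<Rightarrow> 'a::banach \<Rightarrow> 'a"
  assumes "banach_over smul"
    and "operators smul = NRA smul"
  shows "separable_space (euclidean :: 'a topology) \<and> reflexive_space smul"
proof -
  interpret banach_over smul by fact
  note reflexive = NRA_imp_real_reflexive[OF assms(2)]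
  show ?thesis
    using NRA_imp_separable[OF assms(2) reflexive] reflexive_space_of_real[OF reflexive] by simp
qed

end
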